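(* Let $E$ be a finitely or countably generated Hilbert $A$-module over a unital $C^*$-algebra $A$, let $Y=\{y_n\}$ be a standard frame for $E$ with bounds $C$ and $D$, let $W:E\to E$ be an adjointable and bijective operator, and let $x_n=W(y_n)$ for each $n$. Moreover let $U$ be a bounded operator on $\ell^2(A)$ such that $\|U-I\|<C/D$. Then the following statements hold: (1) $X=\{x_n\}$ is a standard frame for $E$. (2) $\mathbf{M}_{U,Y,X}$ is invertible and $\mathbf{M}_{U,Y,X}^{-1}=(W^{-1})^*\,\mathbf{M}_{U,Y,Y}^{-1}$; respectively, $\mathbf{M}_{U,X,Y}$ is invertible and $\mathbf{M}_{U,X,Y}^{-1}=\mathbf{M}_{U,Y,Y}^{-1}\,W^{-1}$.
   Context: Hilbert $A$-modules are left modules whose $A$-valued inner product is $A$-linear in the first argument. $\ell^2(A)$ is the Hilbert $A$-module of sequences $\{a_n\}$ in $A$ such that $\sum_n a_na_n^*$ converges in norm, with $\langle\{a_n\},\{b_n\}\rangle=\sum_n a_nb_n^*$. $I$ is the identity operator on $\ell^2(A)$. A sequence $\{x_n\}\subset E$ is a standard frame if there are constants $C,D>0$ such that for every $x\in E$ the series $\sum_n\langle x,x_n\rangle\langle x_n,x\rangle$ converges in norm and $C\langle x,x\rangle\le\sum_n\langle x,x_n\rangle\langle x_n,x\rangle\le D\langle x,x\rangle$. The optimal constants (maximal $C$, minimal $D$) are called the frame bounds. For a standard frame $X=\{x_n\}$, the analysis operator is $T_X:E\to\ell^2(A)$, $T_Xx=\{\langle x,x_n\rangle\}_n$; it is adjointable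 with adjoint (synthesis operator) $T_X^*(\{a_n\})=\sum_n a_nx_n$. For standard frames $X,Y$ of $E$ and an operator $U$ on $\ell^2(A)$, the generalized multiplier is $\mathbf{M}_{U,Y,X}=T_Y^*UT_X:E\to E$. Invertible means bijective with bounded inverse. *)

theory Defs
  imports "HOL-Analysis.Analysis"
begin

section \<open>Unital C*-algebras\<close>

class complex_vector = ab_group_add + scaleR +
  fixes scaleC :: "complex \<Rightarrow> 'a \<Rightarrow> 'a"  (infixr "*\<^sub>C" 75)
  assumes scaleC_add_right: "c *\<^sub>C (x + y) = c *\<^sub>C x + c *\<^sub>C y"
    and scaleC_add_left: "(c + d) *\<^sub>C x = c *\<^sub>C x + d *\<^sub>C x"
    and scaleC_scaleC: "c *\<^sub>C (d *\<^sub>C x) = (c * d) *\<^sub>C x"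
    and scaleC_one: "1 *\<^sub>C x = x"
    and scaleR_scaleC: "r *\<^sub>R x = complex_of_real r *\<^sub>C x"

(* The axiom "norm 1 = 1" of real_normed_algebra_1 excludes only the zero algebra; its sole
   module is the zero module, which has no optimal frame bounds. *)
class unital_cstar_algebra = complex_vector + real_normed_algebra_1 + banach +
  fixes star :: "'a \<Rightarrow> 'a"
  assumes scaleC_mult_left: "(c *\<^sub>C a) * b = c *\<^sub>C (a * b)"
    and scaleC_mult_right: "a * (c *\<^sub>C b) = c *\<^sub>C (a * b)"
    and norm_scaleC: "norm (c *\<^sub>C a) = cmod c * norm a"
    and star_star: "star (star a) = a"
    and star_add: "star (a + b) = star a + star b"
    and star_scaleC: "star (c *\<^sub>C a) = cnj c *\<^sub>C star a"
    and star_mult: "star (a * b) = star b * star a"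
    and cstar_identity: "norm (star a * a) = (norm a)\<^sup>2"

definition algebra_spectrum :: "'a::unital_cstar_algebra \<Rightarrow> complex set" where
  "algebra_spectrum a =
     {c. \<not> (\<exists>b. (a - c *\<^sub>C 1) * b = 1 \<and> b * (a - c *\<^sub>C 1) = 1)}"

definition cstar_positive :: "'a::unital_cstar_algebra \<Rightarrow> bool" where
  "cstar_positive a \<longleftrightarrow> star a = a \<and> algebra_spectrum a \<subseteq> \<real>\<^sub>\<ge>\<^sub>0"

definition cstar_le :: "'a::unital_cstar_algebra \<Rightarrow> 'a \<Rightarrow> bool"  (infix "\<preceq>" 50) where
  "a \<preceq> b \<longleftrightarrow> cstar_positive (b - a)"

section \<open>Hilbert modules\<close>

(* Completeness is the class banach, for the norm fixed by the last axiom. *)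
locale hilbert_module =
  fixes act :: "'a::unital_cstar_algebra \<Rightarrow> 'e::{complex_vector, banach} \<Rightarrow> 'e"
    and ip :: "'e \<Rightarrow> 'e \<Rightarrow> 'a"
  assumes act_add_right: "act a (x + y) = act a x + act a y"
    and act_add_left: "act (a + b) x = act a x + act b x"
    and act_act: "act a (act b x) = act (a * b) x"
    and act_one: "act 1 x = x"
    and act_scaleC_left: "act (c *\<^sub>C a) x = c *\<^sub>C act a x"
    and act_scaleC_right: "act a (c *\<^sub>C x) = c *\<^sub>C act a x"
    and ip_add_left: "ip (x + y) z = ip x z + ip y z"
    and ip_act_left: "ip (act a x) y = a * ip x y"
    and ip_star: "star (ip x y) = ip y x"
    and ip_positive: "cstar_positive (ip x x)"
    and ip_definite: "ip x x = 0 \<Longrightarrow> x = 0"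
    and norm_ip: "norm x = sqrt (norm (ip x x))"

definition module_span ::
    "('a \<Rightarrow> 'e \<Rightarrow> 'e) \<Rightarrow> 'e set \<Rightarrow> 'e::comm_monoid_add set" where
  "module_span act S = {\<Sum>x\<in>F. act (c x) x | c F. finite F \<and> F \<subseteq> S}"

definition finitely_generated_module ::
    "('a \<Rightarrow> 'e \<Rightarrow> 'e::comm_monoid_add) \<Rightarrow> bool" where
  "finitely_generated_module act \<longleftrightarrow> (\<exists>S. finite S \<and> module_span act S = UNIV)"

(* In the topological sense customary for Hilbert modules: the span is norm dense. *)
definition countably_generated_module ::
    "('a \<Rightarrow> 'e \<Rightarrow> 'e::{comm_monoid_add, topological_space}) \<Rightarrow> bool" where
  "countably_generated_module act \<longleftrightarrow>
     (\<exists>S. countable S \<and> closure (module_span act S) = UNIV)"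

definition bounded_clinear ::
    "('e::{complex_vector, real_normed_vector} \<Rightarrow> 'f::{complex_vector, real_normed_vector}) \<Rightarrow> bool"
  where
  "bounded_clinear T \<longleftrightarrow> bounded_linear T \<and> (\<forall>c x. T (c *\<^sub>C x) = c *\<^sub>C T x)"

definition invertible_op :: "('e::{complex_vector, real_normed_vector} \<Rightarrow> 'e) \<Rightarrow> bool" where
  "invertible_op T \<longleftrightarrow> bij T \<and> bounded_clinear (inv T)"

definition is_adjoint :: "('e \<Rightarrow> 'e \<Rightarrow> 'a) \<Rightarrow> ('e \<Rightarrow> 'e) \<Rightarrow> ('e \<Rightarrow> 'e) \<Rightarrow> bool" where
  "is_adjoint ip T S \<longleftrightarrow> (\<forall>x y. ip (T x) y = ip x (S y))"

definition adjointable :: "('e \<Rightarrow> 'e \<Rightarrow> 'a) \<Rightarrow> ('e \<Rightarrow> 'e) \<Rightarrow> bool" where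
  "adjointable ip T \<longleftrightarrow> (\<exists>S. is_adjoint ip T S)"

definition module_adjoint :: "('e \<Rightarrow> 'e \<Rightarrow> 'a) \<Rightarrow> ('e \<Rightarrow> 'e) \<Rightarrow> 'e \<Rightarrow> 'e" where
  "module_adjoint ip T = (THE S. is_adjoint ip T S)"

section \<open>The standard module of square-summable sequences\<close>

definition ell2 :: "(nat \<Rightarrow> 'a::unital_cstar_algebra) set" where
  "ell2 = {a. summable (\<lambda>n. a n * star (a n))}"

definition ell2_ip ::
    "(nat \<Rightarrow> 'a::unital_cstar_algebra) \<Rightarrow> (nat \<Rightarrow> 'a) \<Rightarrow> 'a" where
  "ell2_ip a b = (\<Sum>n. a n * star (b n))"

definition ell2_norm :: "(nat \<Rightarrow> 'a::unital_cstar_algebra) \<Rightarrow> real" where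
  "ell2_norm a = sqrt (norm (ell2_ip a a))"

(* Linearity is over the complex numbers only; module maps are a special case.
   Values of T outside ell2 are irrelevant here and below. *)
definition ell2_bounded_op ::
    "((nat \<Rightarrow> 'a::unital_cstar_algebra) \<Rightarrow> nat \<Rightarrow> 'a) \<Rightarrow> bool" where
  "ell2_bounded_op T \<longleftrightarrow>
     (\<forall>a\<in>ell2. T a \<in> ell2) \<and>
     (\<forall>a\<in>ell2. \<forall>b\<in>ell2. T (\<lambda>n. a n + b n) = (\<lambda>n. T a n + T b n)) \<and>
     (\<forall>c. \<forall>a\<in>ell2. T (\<lambda>n. c *\<^sub>C a n) = (\<lambda>n. c *\<^sub>C T a n)) \<and>
     (\<exists>K. \<forall>a\<in>ell2. ell2_norm (T a) \<le> K * ell2_norm a)"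

definition ell2_onorm ::
    "((nat \<Rightarrow> 'a::unital_cstar_algebra) \<Rightarrow> nat \<Rightarrow> 'a) \<Rightarrow> real" where
  "ell2_onorm T = (SUP a\<in>{a \<in> ell2. ell2_norm a \<le> 1}. ell2_norm (T a))"

section \<open>Standard frames and generalized multipliers\<close>

definition frame_constants ::
    "('e \<Rightarrow> 'e \<Rightarrow> 'a::unital_cstar_algebra) \<Rightarrow> (nat \<Rightarrow> 'e) \<Rightarrow> real \<Rightarrow> real \<Rightarrow> bool" where
  "frame_constants ip X C D \<longleftrightarrow> 0 < C \<and> 0 < D \<and>
     (\<forall>z. summable (\<lambda>n. ip z (X n) * ip (X n) z) \<and>
          C *\<^sub>R ip z z \<preceq> (\<Sum>n. ip z (X n) * ip (X n) z) \<and>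
          (\<Sum>n. ip z (X n) * ip (X n) z) \<preceq> D *\<^sub>R ip z z)"

definition standard_frame ::
    "('e \<Rightarrow> 'e \<Rightarrow> 'a::unital_cstar_algebra) \<Rightarrow> (nat \<Rightarrow> 'e) \<Rightarrow> bool" where
  "standard_frame ip X \<longleftrightarrow> (\<exists>C D. frame_constants ip X C D)"

definition frame_bounds ::
    "('e \<Rightarrow> 'e \<Rightarrow> 'a::unital_cstar_algebra) \<Rightarrow> (nat \<Rightarrow> 'e) \<Rightarrow> real \<Rightarrow> real \<Rightarrow> bool" where
  "frame_bounds ip X C D \<longleftrightarrow> frame_constants ip X C D \<and>
     (\<forall>C' D'. frame_constants ip X C' D' \<longrightarrow> C' \<le> C \<and> D \<le> D')"

definition analysis_op :: "('e \<Rightarrow> 'e \<Rightarrow> 'a) \<Rightarrow> (nat \<Rightarrow> 'e) \<Rightarrow> 'e \<Rightarrow> nat \<Rightarrow> 'a" where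
  "analysis_op ip X z = (\<lambda>n. ip z (X n))"

definition synthesis_op ::
    "('a \<Rightarrow> 'e \<Rightarrow> 'e) \<Rightarrow> (nat \<Rightarrow> 'e) \<Rightarrow> (nat \<Rightarrow> 'a) \<Rightarrow> 'e::real_normed_vector" where
  "synthesis_op act X a = (\<Sum>n. act (a n) (X n))"

definition gen_multiplier ::
    "('a \<Rightarrow> 'e \<Rightarrow> 'e) \<Rightarrow> ('e \<Rightarrow> 'e \<Rightarrow> 'a) \<Rightarrow> ((nat \<Rightarrow> 'a) \<Rightarrow> nat \<Rightarrow> 'a) \<Rightarrow>
     (nat \<Rightarrow> 'e) \<Rightarrow> (nat \<Rightarrow> 'e) \<Rightarrow> 'e \<Rightarrow> 'e::real_normed_vector" where
  "gen_multiplier act ip U Y X = synthesis_op act Y \<circ> U \<circ> analysis_op ip X"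

end

theory Submission
  imports Defs
begin

text \<open>
  Write T for the analysis operator of Y, so that T* T is the frame operator and C \<le> T* T \<le> D.
  Then 1 - T* T / D is a positive operator bounded by 1 - C / D, and
  T* U T - T* T = T* (U - I) T has norm at most D \<parallel>U - I\<parallel>. Hence
  \<parallel>1 - T* U T / D\<parallel> \<le> 1 - C / D + \<parallel>U - I\<parallel> < 1, and T* U T is invertible by a Neumann series.
  The multipliers involving X factor as T* U T W* and W T* U T; that W* is again bijective with
  bounded inverse follows from the closed graph theorem and the method of continuity for W* W.

  Positivity in a C*-algebra is handled without functional calculus: a self-adjoint h is
  positive iff \<parallel>t - h\<parallel> \<le> t for t = \<parallel>h\<parallel>, which rests on the spectral radius of h being \<parallel>h\<parallel>.
\<close>

section \<open>Invertible elements\<close>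

text \<open>The operator \<open>U\<close> is only complex linear and bounded, so neither it nor the
  multiplier need have an adjoint; invertibility is therefore argued with norms on the Banach space
  alone. The threshold C/D is the gap left by the frame operator: analysis and synthesis each have
  norm at most sqrt D, so after division by D the perturbation costs at most the norm of U - I. Two
  obstacles shape the rest. The spectrum of a sum of noncommuting elements is hard to reach, whereas
  the norm form of positivity passes through sums and limits. Its price is the spectral radius of a
  self-adjoint element, obtained by averaging resolvents over roots of unity; powers of two are
  enough there, because the C*-identity computes exactly those norms. Secondly, closed submodules
  need not be complemented, so surjectivity of the adjoint of \<open>W\<close> cannot be read off
  from \<open>W\<close> being injective with closed range. It is reached through the composite of
  \<open>W\<close> with its adjoint, and only then is \<open>inv W\<close> known to be
  adjointable.\<close>

definition invertible_elem :: "'a::monoid_mult \<Rightarrow> bool" where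
  "invertible_elem a \<longleftrightarrow> (\<exists>b. a * b = 1 \<and> b * a = 1)"

definition elem_inv :: "'a::monoid_mult \<Rightarrow> 'a" where
  "elem_inv a = (THE b. a * b = 1 \<and> b * a = 1)"

lemma inverse_unique_monoid:
  fixes a b c :: "'a::monoid_mult"
  assumes "a * b = 1" "c * a = 1"
  shows "b = c"
  by (metis assms mult.assoc mult_1_left mult_1_right)

lemma elem_inv:
  assumes "invertible_elem a"
  shows "a * elem_inv a = 1" "elem_inv a * a = 1"
proof -
  obtain b where b: "a * b = 1 \<and> b * a = 1"
    using assms by (auto simp: invertible_elem_def)
  have "a * elem_inv a = 1 \<and> elem_inv a * a = 1"
    unfolding elem_inv_def
    by (rule theI[of _ b]) (use b inverse_unique_monoid in \<open>blast+\<close>)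
  then show "a * elem_inv a = 1" "elem_inv a * a = 1" by auto
qed

lemma elem_inv_eqI: "a * b = 1 \<Longrightarrow> b * a = 1 \<Longrightarrow> elem_inv a = b"
  by (metis elem_inv(2) inverse_unique_monoid invertible_elem_def)

lemma invertible_elemI: "a * b = 1 \<Longrightarrow> b * a = 1 \<Longrightarrow> invertible_elem a"
  by (auto simp: invertible_elem_def)

lemma invertible_elem_inv: "invertible_elem a \<Longrightarrow> invertible_elem (elem_inv a)"
  by (auto intro: invertible_elemI elem_inv)

lemma invertible_elem_mult:
  assumes "invertible_elem a" "invertible_elem b"
  shows "invertible_elem (a * b)" "elem_inv (a * b) = elem_inv b * elem_inv a"
proof -
  have 1: "(a * b) * (elem_inv b * elem_inv a) = 1" "(elem_inv b * elem_inv a) * (a * b) = 1"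
    using elem_inv[OF assms(1)] elem_inv[OF assms(2)]
    by (metis mult.assoc mult_1_right)+
  show "invertible_elem (a * b)" "elem_inv (a * b) = elem_inv b * elem_inv a"
    by (rule invertible_elemI[OF 1], rule elem_inv_eqI[OF 1])
qed

text \<open>Commutation turns the inverse of the product into both a right and a left inverse of
  \<open>a\<close>, and these must agree. This later isolates one factor of a quadratic in a single
  element.\<close>

lemma invertible_elem_mult_commute:
  assumes "a * b = b * a" "invertible_elem (a * b)"
  shows "invertible_elem a"
proof -
  let ?c = "elem_inv (a * b)"
  have 1: "a * (b * ?c) = 1" using elem_inv(1)[OF assms(2)] by (simp add: mult.assoc)
  have 2: "(?c * b) * a = 1" using elem_inv(2)[OF assms(2)] assms(1) by (simp add: mult.assoc)
  show ?thesis using 1 2 inverse_unique_monoid[OF 1 2] by (auto intro: invertible_elemI)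
qed

lemma invertible_elem_mult_left_iff:
  assumes "invertible_elem a"
  shows "invertible_elem (a * b) \<longleftrightarrow> invertible_elem b"
proof
  assume "invertible_elem (a * b)"
  then have "invertible_elem (elem_inv a * (a * b))"
    by (rule invertible_elem_mult(1)[OF invertible_elem_inv[OF assms]])
  then show "invertible_elem b"
    using elem_inv(2)[OF assms] by (simp add: mult.assoc[symmetric])
qed (simp add: invertible_elem_mult assms)

text \<open>The resolvent identity, ordered so that it holds without commutativity.\<close>

lemma elem_inv_diff:
  fixes a b :: "'a::ring_1"
  assumes "invertible_elem a" "invertible_elem b"
  shows "elem_inv a - elem_inv b = elem_inv a * (b - a) * elem_inv b"
proof -
  have "elem_inv a * (b - a) * elem_inv b
      = elem_inv a * (b * elem_inv b) - (elem_inv a * a) * elem_inv b"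
    by (simp add: right_diff_distrib left_diff_distrib mult.assoc)
  then show ?thesis by (simp add: elem_inv assms)
qed

lemma neumann_series:
  fixes x :: "'a::{real_normed_algebra_1, banach}"
  assumes "norm x < 1"
  shows "invertible_elem (1 - x)" "norm (elem_inv (1 - x)) \<le> 1 / (1 - norm x)"
proof -
  define b where "b = (\<Sum>n. x ^ n)"
  note s = complete_algebra_summable_geometric[OF assms]
  have "(\<Sum>n. x ^ Suc n) = b - 1"
    using suminf_split_head[OF s] by (simp add: b_def)
  moreover have "(\<Sum>n. x ^ Suc n) = x * b"
    using suminf_mult[OF s, of x] by (simp add: b_def)
  moreover have "(\<Sum>n. x ^ Suc n) = b * x"
    using suminf_mult2[OF s, of x] by (simp add: b_def power_commutes)
  ultimately have 1: "x * b = b - 1" "b * x = b - 1" by simp_all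
  have 2: "(1 - x) * b = 1" "b * (1 - x) = 1"
    using 1 by (simp_all add: algebra_simps)
  show "invertible_elem (1 - x)" by (rule invertible_elemI[OF 2])
  \<comment> \<open>The fixed point equation b = 1 + x b gives the bound directly, by solving norm b
    <= 1 + norm x * norm b.\<close>
  have "norm b = norm (1 + x * b)" using 1 by simp
  also have "\<dots> \<le> 1 + norm x * norm b"
    by (metis add_left_mono norm_mult_ineq norm_one norm_triangle_ineq order_trans)
  finally show "norm (elem_inv (1 - x)) \<le> 1 / (1 - norm x)"
    using elem_inv_eqI[OF 2] assms by (simp add: field_simps)
qed

text \<open>Factor a - d as a times 1 - a^(-1) d. The factor 2 is the Neumann bound at norm 1/2; it
  makes the resolvent locally bounded.\<close>

lemma invertible_elem_perturb:
  fixes a d :: "'a::{real_normed_algebra_1, banach}"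
  assumes "invertible_elem a" "norm (elem_inv a) * norm d \<le> 1 / 2"
  shows "invertible_elem (a - d)" "norm (elem_inv (a - d)) \<le> 2 * norm (elem_inv a)"
proof -
  let ?x = "elem_inv a * d"
  have x: "norm ?x \<le> 1 / 2" using assms(2) norm_mult_ineq[of "elem_inv a" d] by linarith
  have eq: "a - d = a * (1 - ?x)"
    using elem_inv[OF assms(1)] by (simp add: algebra_simps mult.assoc[symmetric])
  have i: "invertible_elem (1 - ?x)" by (rule neumann_series(1)) (use x in linarith)
  show "invertible_elem (a - d)" unfolding eq by (intro invertible_elem_mult assms i)
  have "norm (elem_inv (1 - ?x)) \<le> 1 / (1 - norm ?x)" using neumann_series(2)[of ?x] x by linarith
  also have "\<dots> \<le> 2" using x by (simp add: field_simps)
  finally have "norm (elem_inv (1 - ?x)) \<le> 2" .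
  then show "norm (elem_inv (a - d)) \<le> 2 * norm (elem_inv a)"
    unfolding eq invertible_elem_mult(2)[OF assms(1) i]
    by (intro order_trans[OF norm_mult_ineq] mult_right_mono) auto
qed

text \<open>Serves in both directions: a small element has resolvent near 1, and, applied to 1 minus
  a resolvent, a resolvent near 1 forces the element to be small.\<close>

lemma elem_inv_near_one:
  fixes x :: "'a::{real_normed_algebra_1, banach}"
  assumes "norm x \<le> 1 / 2"
  shows "invertible_elem (1 - x)" "norm (elem_inv (1 - x) - 1) \<le> 2 * norm x"
proof -
  show i: "invertible_elem (1 - x)" by (rule neumann_series(1)) (use assms in linarith)
  have "norm (elem_inv (1 - x)) \<le> 1 / (1 - norm x)" using neumann_series(2)[of x] assms by linarith
  also have "\<dots> \<le> 2" using assms by (simp add: field_simps)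
  finally have n: "norm (elem_inv (1 - x)) \<le> 2" .
  have "elem_inv (1 - x) - 1 = x * elem_inv (1 - x)"
    using elem_inv(1)[OF i] by (simp add: algebra_simps)
  then show "norm (elem_inv (1 - x) - 1) \<le> 2 * norm x"
    using norm_mult_ineq[of x "elem_inv (1 - x)"] mult_left_mono[OF n norm_ge_zero[of x]] by simp
qed

lemma elem_inv_one_minus_square:
  fixes y :: "'a::real_algebra_1"
  assumes "invertible_elem (1 - y)" "invertible_elem (1 + y)"
  shows "invertible_elem (1 - y * y)"
    "elem_inv (1 - y * y) = (1/2) *\<^sub>R (elem_inv (1 - y) + elem_inv (1 + y))"
proof -
  let ?p = "elem_inv (1 - y)" and ?m = "elem_inv (1 + y)"
  have eq: "1 - y * y = (1 - y) * (1 + y)" "1 - y * y = (1 + y) * (1 - y)"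
    by (simp_all add: algebra_simps)
  have "(1 - y * y) * (?p + ?m) = (1 + y) * ((1 - y) * ?p) + (1 - y) * ((1 + y) * ?m)"
    by (metis eq mult.assoc distrib_left)
  then have 1: "(1 - y * y) * ((1/2) *\<^sub>R (?p + ?m)) = 1"
    using elem_inv[OF assms(1)] elem_inv[OF assms(2)]
    by (simp flip: scaleR_2)
  have "(?p + ?m) * (1 - y * y) = (?p * (1 - y)) * (1 + y) + (?m * (1 + y)) * (1 - y)"
    by (metis eq mult.assoc distrib_right)
  then have 2: "((1/2) *\<^sub>R (?p + ?m)) * (1 - y * y) = 1"
    using elem_inv[OF assms(1)] elem_inv[OF assms(2)]
    by (simp flip: scaleR_2)
  show "invertible_elem (1 - y * y)" "elem_inv (1 - y * y) = (1/2) *\<^sub>R (?p + ?m)"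
    by (rule invertible_elemI[OF 1 2], rule elem_inv_eqI[OF 1 2])
qed

section \<open>Spectral radius\<close>

lemma scaleC_zero_right [simp]: "c *\<^sub>C (0::'a::complex_vector) = 0"
  by (metis add_cancel_right_right scaleC_add_right)

lemma scaleC_zero_left [simp]: "0 *\<^sub>C (x::'a::complex_vector) = 0"
  by (metis add_cancel_right_right scaleC_add_left)

lemma scaleC_minus_left: "(- c) *\<^sub>C (x::'a::complex_vector) = - (c *\<^sub>C x)"
  by (metis add.right_inverse eq_neg_iff_add_eq_0 scaleC_add_left scaleC_zero_left add.commute)

lemma scaleC_minus_right: "c *\<^sub>C (- x::'a::complex_vector) = - (c *\<^sub>C x)"
  by (metis add.right_inverse eq_neg_iff_add_eq_0 scaleC_add_right scaleC_zero_right add.commute)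

lemma scaleC_diff_left: "(c - d) *\<^sub>C (x::'a::complex_vector) = c *\<^sub>C x - d *\<^sub>C x"
  using scaleC_add_left[of c "- d" x] by (simp add: scaleC_minus_left)

lemma scaleC_diff_right: "c *\<^sub>C (x - y::'a::complex_vector) = c *\<^sub>C x - c *\<^sub>C y"
  using scaleC_add_right[of c x "- y"] by (simp add: scaleC_minus_right)

lemma scaleC_power:
  fixes a :: "'a::unital_cstar_algebra"
  shows "(c *\<^sub>C a) ^ n = (c ^ n) *\<^sub>C (a ^ n)"
  by (induction n) (simp_all add: scaleC_one scaleC_mult_left scaleC_mult_right scaleC_scaleC mult.commute)

lemma scaleC_of_real: "complex_of_real r *\<^sub>C x = r *\<^sub>R x"
  by (simp add: scaleR_scaleC)

text \<open>Points with exploding resolvent norms would accumulate at some \<open>l\<close> in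
  \<open>K\<close>, but near \<open>l\<close> the perturbation bound caps the norm at twice its
  value at \<open>l\<close>.\<close>

lemma resolvent_bounded:
  fixes a :: "'a::unital_cstar_algebra"
  assumes "compact K" "\<And>z. z \<in> K \<Longrightarrow> invertible_elem (1 - z *\<^sub>C a)"
  obtains G where "G > 0" "\<And>z. z \<in> K \<Longrightarrow> norm (elem_inv (1 - z *\<^sub>C a)) \<le> G"
proof -
  let ?g = "\<lambda>z. norm (elem_inv (1 - z *\<^sub>C a))"
  have "\<exists>G. \<forall>z\<in>K. ?g z \<le> G"
  proof (rule ccontr)
    assume "\<not> ?thesis"
    then have "\<forall>n. \<exists>z\<in>K. ?g z > real n" by (meson not_le)
    then obtain z where z: "\<And>n. z n \<in> K" "\<And>n. ?g (z n) > real n" by metis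
    obtain l r where l: "l \<in> K" "strict_mono r" "(z \<circ> r) \<longlonglongrightarrow> l"
      using \<open>compact K\<close> z(1) unfolding compact_def by blast
    have "(\<lambda>n. ?g l * norm ((z (r n) - l) *\<^sub>C a)) \<longlonglongrightarrow> ?g l * (cmod (l - l) * norm a)"
      using l(3) unfolding norm_scaleC by (intro tendsto_intros) (simp add: o_def)
    then have "eventually (\<lambda>n. ?g l * norm ((z (r n) - l) *\<^sub>C a) < 1/2) sequentially"
      by (intro order_tendstoD(2)[of _ "?g l * (cmod (l - l) * norm a)"]) auto
    moreover have "eventually (\<lambda>n. real n > 2 * ?g l) sequentially"
      using filterlim_real_sequentially by (simp add: filterlim_at_top_dense)
    ultimately have "eventually (\<lambda>n. False) sequentially"
    proof eventually_elim
      case (elim n)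
      have "1 - z (r n) *\<^sub>C a = (1 - l *\<^sub>C a) - (z (r n) - l) *\<^sub>C a"
        by (simp add: scaleC_diff_left)
      then have "?g (z (r n)) \<le> 2 * ?g l"
        using invertible_elem_perturb(2)[OF assms(2)[OF l(1)], of "(z (r n) - l) *\<^sub>C a"] elim
        by (metis less_imp_le)
      moreover have "?g (z (r n)) > real n"
        using z(2)[of "r n"] seq_suble[OF l(2), of n] by linarith
      ultimately show ?case using elim by linarith
    qed
    then show False by simp
  qed
  then obtain G where "\<forall>z\<in>K. ?g z \<le> G" by blast
  then show thesis by (intro that[of "max G 1"]) (auto simp: le_max_iff_disj)
qed

lemma exists_root_minus_one:
  assumes "n > 0"
  obtains \<zeta> :: complex where "cmod \<zeta> = 1" "\<zeta> ^ n = - 1"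
proof
  show "cmod (cis (pi / n)) = 1" by simp
  show "cis (pi / n) ^ n = - 1" using assms by (simp add: Complex.DeMoivre complex_eq_iff)
qed

text \<open>
  Doubling step of the root-of-unity average: since
  2 (1 - y^2)^(-1) = (1 - y)^(-1) + (1 + y)^(-1), the resolvents of the powers a^(2^j)
  on a circle inherit any radial Lipschitz bound of the resolvent of a itself.
\<close>

lemma resolvent_power_lipschitz:
  fixes a :: "'a::unital_cstar_algebra"
  assumes inv: "\<And>z. cmod z \<le> 1 \<Longrightarrow> invertible_elem (1 - z *\<^sub>C a)"
    and lip: "\<And>w. cmod w = 1 \<Longrightarrow>
      norm (elem_inv (1 - w *\<^sub>C a) - elem_inv (1 - (of_real \<rho> * w) *\<^sub>C a)) \<le> L"
    and \<rho>: "0 \<le> \<rho>" "\<rho> \<le> 1"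
  shows "(\<forall>z. cmod z \<le> 1 \<longrightarrow> invertible_elem (1 - (z *\<^sub>C a) ^ (2 ^ j))) \<and>
    (\<forall>w. cmod w = 1 \<longrightarrow>
      norm (elem_inv (1 - (w *\<^sub>C a) ^ (2 ^ j))
          - elem_inv (1 - ((of_real \<rho> * w) *\<^sub>C a) ^ (2 ^ j))) \<le> L)"
proof (induction j)
  case 0
  then show ?case using inv lip by simp
next
  case (Suc j)
  let ?n = "2 ^ j :: nat"
  obtain \<zeta> :: complex where \<zeta>: "cmod \<zeta> = 1" "\<zeta> ^ ?n = - 1"
    using exists_root_minus_one[of ?n] by auto
  \<comment> \<open>Multiplying \<open>z\<close> by a root of -1 absorbs the sign without changing
    the modulus, so the induction hypothesis covers both factors of 1 - y^2.\<close>
  have plus: "1 + (z *\<^sub>C a) ^ ?n = 1 - ((\<zeta> * z) *\<^sub>C a) ^ ?n" for z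
    by (simp add: scaleC_power power_mult_distrib \<zeta> scaleC_minus_left)
  have sq: "(z *\<^sub>C a) ^ (2 ^ Suc j) = (z *\<^sub>C a) ^ ?n * (z *\<^sub>C a) ^ ?n" for z
    by (simp add: power_add[symmetric] mult_2)
  have I: "invertible_elem (1 - (z *\<^sub>C a) ^ ?n)" "invertible_elem (1 + (z *\<^sub>C a) ^ ?n)"
    if "cmod z \<le> 1" for z
    using Suc that \<zeta>(1) unfolding plus by (auto simp: norm_mult)
  let ?f = "\<lambda>z. elem_inv (1 - (z *\<^sub>C a) ^ ?n)"
  have F: "elem_inv (1 - (z *\<^sub>C a) ^ (2 ^ Suc j)) = (1/2) *\<^sub>R (?f z + ?f (\<zeta> * z))"
    if "cmod z \<le> 1" for z
    unfolding sq elem_inv_one_minus_square(2)[OF I[OF that]] plus ..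
  show ?case
  proof (intro conjI allI impI)
    fix z assume "cmod z \<le> 1"
    then show "invertible_elem (1 - (z *\<^sub>C a) ^ (2 ^ Suc j))"
      unfolding sq by (intro elem_inv_one_minus_square(1) I)
  next
    fix w assume w: "cmod w = 1"
    have w': "cmod (of_real \<rho> * w) \<le> 1" using w \<rho> by (simp add: norm_mult)
    have e: "elem_inv (1 - (w *\<^sub>C a) ^ (2 ^ Suc j))
        - elem_inv (1 - ((of_real \<rho> * w) *\<^sub>C a) ^ (2 ^ Suc j))
      = (1/2) *\<^sub>R ((?f w - ?f (of_real \<rho> * w)) + (?f (\<zeta> * w) - ?f (of_real \<rho> * (\<zeta> * w))))"
      using F[of w] F[OF w'] w by (simp add: algebra_simps mult.left_commute)
    have "norm (?f w - ?f (of_real \<rho> * w)) \<le> L"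
      "norm (?f (\<zeta> * w) - ?f (of_real \<rho> * (\<zeta> * w))) \<le> L"
      using Suc w \<zeta>(1) by (auto simp: norm_mult)
    then have "norm ((?f w - ?f (of_real \<rho> * w)) + (?f (\<zeta> * w) - ?f (of_real \<rho> * (\<zeta> * w)))) \<le> L + L"
      by (rule norm_triangle_mono)
    then show "norm (elem_inv (1 - (w *\<^sub>C a) ^ (2 ^ Suc j))
        - elem_inv (1 - ((of_real \<rho> * w) *\<^sub>C a) ^ (2 ^ Suc j))) \<le> L"
      unfolding e by simp
  qed
qed

text \<open>The spectral radius theorem in disguise. The resolvent of a^(2^j) at 1 differs from the
  one at a shrunken point by an amount independent of j, while (\<rho> a)^(2^j) tends to 0, so the
  latter resolvent tends to 1. Hence the resolvent of a^(2^j) is near 1 and the power itself is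
  small.\<close>

lemma power_two_power_norm_less_one:
  fixes a :: "'a::unital_cstar_algebra"
  assumes "norm a \<le> 1" "\<And>z. cmod z = 1 \<Longrightarrow> invertible_elem (1 - z *\<^sub>C a)"
  shows "\<exists>j. norm (a ^ (2 ^ j)) < 1"
proof -
  have inv: "invertible_elem (1 - z *\<^sub>C a)" if "cmod z \<le> 1" for z
  proof (cases "cmod z = 1")
    case False
    then have "norm (z *\<^sub>C a) < 1"
      unfolding norm_scaleC using that assms(1)
      by (meson mult_left_le norm_ge_zero le_less_trans order.strict_iff_order)
    then show ?thesis by (rule neumann_series(1))
  qed (use assms in auto)
  obtain G where G: "G > 0" "\<And>z. cmod z \<le> 1 \<Longrightarrow> norm (elem_inv (1 - z *\<^sub>C a)) \<le> G"
    using resolvent_bounded[of "cball 0 1" a] inv by auto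
  \<comment> \<open>Chosen so that the resolvent identity, with both resolvents bounded by
    \<open>G\<close>, yields a difference of at most 1/8; the maximum with 0 keeps the point in the
    disc.\<close>
  define \<rho> where "\<rho> = max 0 (1 - 1 / (8 * G\<^sup>2))"
  have \<rho>: "0 \<le> \<rho>" "\<rho> < 1" "(1 - \<rho>) * G\<^sup>2 \<le> 1 / 8"
    using G(1) by (auto simp: \<rho>_def max_def field_simps)
  have lip: "norm (elem_inv (1 - w *\<^sub>C a) - elem_inv (1 - (of_real \<rho> * w) *\<^sub>C a)) \<le> 1 / 8"
    if w: "cmod w = 1" for w
  proof -
    let ?p = "1 - w *\<^sub>C a" and ?q = "1 - (of_real \<rho> * w) *\<^sub>C a"
    have w': "cmod (of_real \<rho> * w) \<le> 1" using w \<rho> by (simp add: norm_mult)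
    have ip: "invertible_elem ?p" "invertible_elem ?q" using inv w w' by auto
    have "elem_inv ?p - elem_inv ?q = elem_inv ?p * (?q - ?p) * elem_inv ?q"
      by (rule elem_inv_diff[OF ip])
    also have "?q - ?p = ((1 - of_real \<rho>) * w) *\<^sub>C a"
      by (simp add: scaleC_diff_left left_diff_distrib)
    finally have "norm (elem_inv ?p - elem_inv ?q)
        \<le> norm (elem_inv ?p) * norm (((1 - of_real \<rho>) * w) *\<^sub>C a) * norm (elem_inv ?q)"
      by (simp add: order_trans[OF norm_mult_ineq] mult_right_mono norm_mult_ineq)
    also have "norm (((1 - of_real \<rho>) * w) *\<^sub>C a) = (1 - \<rho>) * norm a"
    proof -
      have "cmod (1 - of_real \<rho>) = 1 - \<rho>"
        using \<rho> norm_of_real[of "1 - \<rho>", where 'a = complex] by simp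
      then show ?thesis using w by (simp add: norm_scaleC norm_mult)
    qed
    also have "norm (elem_inv ?p) * ((1 - \<rho>) * norm a) * norm (elem_inv ?q) \<le> G * ((1 - \<rho>) * 1) * G"
      using G w w' \<rho> assms(1) by (intro mult_mono mult_nonneg_nonneg) auto
    also have "\<dots> \<le> 1 / 8" using \<rho>(3) by (simp add: power2_eq_square algebra_simps)
    finally show ?thesis .
  qed
  have "(\<lambda>j. \<rho> ^ j) \<longlonglongrightarrow> 0" using \<rho> by (intro LIMSEQ_power_zero) simp
  then have "eventually (\<lambda>j. \<rho> ^ j < 1/16) sequentially" by (rule order_tendstoD(2)) simp
  then obtain j where j: "\<rho> ^ j < 1 / 16" by (auto simp: eventually_sequentially)
  let ?n = "2 ^ j :: nat"
  let ?x = "a ^ ?n" and ?y = "((of_real \<rho> * 1) *\<^sub>C a) ^ ?n"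
  have "norm ?y \<le> (\<rho> * norm a) ^ ?n"
    using norm_power_ineq[of "(of_real \<rho> * 1) *\<^sub>C a" ?n] \<rho> by (simp add: norm_scaleC)
  also have "\<dots> \<le> \<rho> ^ ?n"
    using \<rho> assms(1) by (intro power_mono) (auto intro: mult_left_le)
  also have "\<dots> \<le> \<rho> ^ j" using \<rho> by (intro power_decreasing) auto
  finally have y: "norm ?y \<le> 1 / 16" using j by simp
  have 1: "norm (elem_inv (1 - ?y) - 1) \<le> 1 / 8" using elem_inv_near_one(2)[of ?y] y by simp
  have R: "invertible_elem (1 - (1 *\<^sub>C a) ^ ?n)"
    "norm (elem_inv (1 - (1 *\<^sub>C a) ^ ?n) - elem_inv (1 - ?y)) \<le> 1 / 8"
    using resolvent_power_lipschitz[of a \<rho> "1/8" j, OF inv lip] \<rho> by (auto simp del: mult_1_right)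
  then have i: "invertible_elem (1 - ?x)" and 2: "norm (elem_inv (1 - ?x) - elem_inv (1 - ?y)) \<le> 1 / 8"
    by (simp_all add: scaleC_one)
  \<comment> \<open>The two errors of 1/8 add up to 1/4. Since 1 - d and 1 - a^(2^j) are mutually
    inverse, inverting back costs another factor 2 and leaves 1/2.\<close>
  define d where "d = 1 - elem_inv (1 - ?x)"
  have d: "norm d \<le> 1 / 4"
    unfolding d_def using norm_triangle_ineq[of "elem_inv (1 - ?x) - elem_inv (1 - ?y)" "elem_inv (1 - ?y) - 1"] 1 2
    by (simp add: norm_minus_commute)
  have "elem_inv (1 - d) = 1 - ?x" using elem_inv[OF i] by (intro elem_inv_eqI) (simp_all add: d_def)
  then have "norm ?x \<le> 1 / 2" using elem_inv_near_one(2)[of d] d by simp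
  then show ?thesis by (intro exI[of _ j]) simp
qed

section \<open>The positive cone of a C*-algebra\<close>

lemma star_zero [simp]: "star (0::'a::unital_cstar_algebra) = 0"
  by (metis add_cancel_right_right star_add)

lemma star_minus: "star (- a) = - star (a::'a::unital_cstar_algebra)"
  by (metis add.right_inverse add_eq_0_iff star_add star_zero)

lemma star_diff: "star (a - b) = star a - star (b::'a::unital_cstar_algebra)"
  using star_add[of a "- b"] by (simp add: star_minus)

lemma star_one [simp]: "star (1::'a::unital_cstar_algebra) = 1"
  by (metis mult_1_left mult_1_right star_mult star_star)

lemma star_scaleR: "star (r *\<^sub>R a) = r *\<^sub>R star (a::'a::unital_cstar_algebra)"
  by (simp add: scaleR_scaleC star_scaleC)

lemma star_sum: "star (sum f F) = (\<Sum>i\<in>F. star (f i ::'a::unital_cstar_algebra))"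
  by (induction F rule: infinite_finite_induct) (simp_all add: star_add)

text \<open>Only the C*-identity is an axiom; with submultiplicativity it gives norm b <= norm (star
  b), and applying this to \<open>star a\<close> as well gives equality.\<close>

lemma norm_star: "norm (star a) = norm (a::'a::unital_cstar_algebra)"
proof -
  have "norm b \<le> norm (star b)" for b :: 'a
  proof (cases "b = 0")
    case False
    have "norm b * norm b \<le> norm (star b) * norm b"
      using norm_mult_ineq[of "star b" b] by (simp add: cstar_identity power2_eq_square)
    then show ?thesis using False by simp
  qed simp
  from this[of a] this[of "star a"] show ?thesis by (simp add: star_star)
qed

lemma norm_mult_star: "norm (a * star a) = (norm (a::'a::unital_cstar_algebra))\<^sup>2"
  using cstar_identity[of "star a"] by (simp add: star_star norm_star)

lemma bounded_linear_star: "bounded_linear (star :: 'a::unital_cstar_algebra \<Rightarrow> 'a)"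
  by (rule bounded_linear_intro[of _ 1]) (simp_all add: star_add star_scaleR norm_star)

lemma invertible_elem_scaleC:
  fixes a :: "'a::unital_cstar_algebra"
  assumes "c \<noteq> 0"
  shows "invertible_elem (c *\<^sub>C a) \<longleftrightarrow> invertible_elem a"
proof -
  have "invertible_elem (c *\<^sub>C 1 :: 'a)"
    by (rule invertible_elemI[of _ "inverse c *\<^sub>C 1"])
       (simp_all add: scaleC_mult_left scaleC_scaleC scaleC_one assms)
  from invertible_elem_mult_left_iff[OF this, of a] show ?thesis
    by (simp add: scaleC_mult_left)
qed

lemma invertible_elem_scaleR:
  fixes a :: "'a::unital_cstar_algebra"
  shows "r \<noteq> 0 \<Longrightarrow> invertible_elem (r *\<^sub>R a) \<longleftrightarrow> invertible_elem a"
  by (simp add: scaleR_scaleC invertible_elem_scaleC)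

lemma invertible_elem_minus:
  fixes a :: "'a::unital_cstar_algebra"
  shows "invertible_elem (- a) \<longleftrightarrow> invertible_elem a"
  using invertible_elem_scaleR[of "-1" a] by simp

lemma algebra_spectrum_iff: "c \<in> algebra_spectrum a \<longleftrightarrow> \<not> invertible_elem (a - c *\<^sub>C 1)"
  by (simp add: algebra_spectrum_def invertible_elem_def)

lemma invertible_elem_norm_less:
  fixes a :: "'a::unital_cstar_algebra"
  assumes "norm a < cmod c"
  shows "invertible_elem (a - c *\<^sub>C 1)"
proof -
  have c: "c \<noteq> 0" using assms by auto
  have "norm (inverse c *\<^sub>C a) = norm a / cmod c"
    by (simp add: norm_scaleC norm_inverse divide_inverse mult.commute)
  then have "norm (inverse c *\<^sub>C a) < 1"
    using assms c by simp
  then have "invertible_elem ((- c) *\<^sub>C (1 - inverse c *\<^sub>C a))"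
    using neumann_series(1) c by (simp add: invertible_elem_scaleC)
  also have "(- c) *\<^sub>C (1 - inverse c *\<^sub>C a) = a - c *\<^sub>C 1"
    using c by (simp add: scaleC_diff_right scaleC_scaleC scaleC_minus_left scaleC_one)
  finally show ?thesis .
qed

lemma invertible_elem_norm_less_real:
  fixes a :: "'a::unital_cstar_algebra"
  assumes "norm a < \<bar>r\<bar>"
  shows "invertible_elem (a - r *\<^sub>R 1)"
  using invertible_elem_norm_less[of a "of_real r"] assms by (simp add: scaleC_of_real)

text \<open>
  Shifting h by i t changes the norm only to second order in t, which forces the imaginary
  part of a spectral value to vanish.
\<close>

lemma spectrum_selfadjoint_real:
  fixes h :: "'a::unital_cstar_algebra"
  assumes "star h = h" "Im c \<noteq> 0"
  shows "invertible_elem (h - c *\<^sub>C 1)"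
proof -
  \<comment> \<open>The square of |c + i t| is |c|^2 + 2 t Im c + t^2. This \<open>t\<close> makes
    the middle term exceed (norm h)^2, so the shifted spectral value lies outside the disc of radius
    \<open>norm k\<close>.\<close>
  define t where "t = ((norm h)\<^sup>2 + 1) / (2 * Im c)"
  define k where "k = h + (\<i> * of_real t) *\<^sub>C 1"
  have "star k * k = h * h + t\<^sup>2 *\<^sub>R 1"
    unfolding k_def
    by (simp add: star_add star_scaleC assms(1) algebra_simps scaleC_mult_left scaleC_mult_right
        scaleC_scaleC scaleC_minus_left scaleC_add_right scaleC_diff_right power2_eq_square
        flip: scaleC_of_real)
  then have "(norm k)\<^sup>2 = norm (h * h + t\<^sup>2 *\<^sub>R 1)"
    using cstar_identity[of k] by simp
  also have "\<dots> \<le> (norm h)\<^sup>2 + t\<^sup>2"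
    by (rule norm_triangle_le) (simp add: norm_mult_ineq power2_eq_square)
  also have "\<dots> < (cmod (c + \<i> * of_real t))\<^sup>2"
  proof -
    have "2 * Im c * t = (norm h)\<^sup>2 + 1" using assms(2) by (simp add: t_def)
    then show ?thesis
      unfolding cmod_power2 by (simp add: power2_sum) (smt (verit) zero_le_power2)
  qed
  finally have "norm k < cmod (c + \<i> * of_real t)"
    by (rule power2_less_imp_less) simp
  from invertible_elem_norm_less[OF this] show ?thesis
    by (simp add: k_def scaleC_add_left)
qed

lemma norm_power_two_power:
  fixes h :: "'a::unital_cstar_algebra"
  assumes "star h = h"
  shows "norm (h ^ (2 ^ j)) = norm h ^ (2 ^ j)"
proof (induction j)
  case (Suc j)
  have "star (h ^ n) = h ^ n" for n
    by (induction n) (simp_all add: star_mult assms power_commutes)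
  then have "norm (h ^ (2 ^ j) * h ^ (2 ^ j)) = (norm (h ^ (2 ^ j)))\<^sup>2"
    using cstar_identity[of "h ^ (2 ^ j)"] by simp
  then show ?case using Suc by (simp add: power_add[symmetric] mult_2 power2_eq_square)
qed simp

text \<open>If the norm exceeded \<open>t\<close>, then h divided by its norm would have no spectrum
  on the unit circle: nonreal points are excluded by self-adjointness, real ones by hypothesis. Some
  power a^(2^j) would then have norm below 1, although all of them have norm 1.\<close>

lemma norm_le_of_spectrum:
  fixes h :: "'a::unital_cstar_algebra"
  assumes "star h = h" "t \<ge> 0" "\<And>r. \<bar>r\<bar> > t \<Longrightarrow> invertible_elem (h - r *\<^sub>R 1)"
  shows "norm h \<le> t"
proof (rule ccontr)
  assume "\<not> norm h \<le> t"
  then have n: "norm h > t" by simp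
  define a where "a = (1 / norm h) *\<^sub>R h"
  have a: "norm a = 1" "star a = a" using n assms by (auto simp: a_def star_scaleR)
  have "invertible_elem (1 - z *\<^sub>C a)" if z: "cmod z = 1" for z
  proof -
    \<comment> \<open>The point at which h - c is a nonzero multiple of 1 - z a.\<close>
    define c where "c = of_real (norm h) / z"
    have c: "cmod c = norm h" using z by (simp add: c_def norm_divide)
    have "invertible_elem (h - c *\<^sub>C 1)"
    proof (cases "Im c = 0")
      case True
      then have c': "c = of_real (Re c)" by (simp add: complex_eq_iff)
      then have "\<bar>Re c\<bar> = norm h" using c by (metis norm_of_real)
      then show ?thesis using assms(3)[of "Re c"] n c' by (metis scaleC_of_real)
    qed (use spectrum_selfadjoint_real assms in auto)
    then have "invertible_elem ((- (z / of_real (norm h))) *\<^sub>C (h - c *\<^sub>C 1))"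
      using z n assms(2) by (subst invertible_elem_scaleC) auto
    also have "(- (z / of_real (norm h))) *\<^sub>C (h - c *\<^sub>C 1) = 1 - z *\<^sub>C a"
      using z n assms(2)
      by (auto simp: c_def a_def scaleC_diff_right scaleC_scaleC scaleC_minus_left scaleC_one
          scaleR_scaleC)
    finally show ?thesis .
  qed
  from power_two_power_norm_less_one[OF _ this] a obtain j where "norm (a ^ (2 ^ j)) < 1"
    by auto
  then show False using norm_power_two_power[OF a(2)] a(1) by simp
qed

text \<open>Self-adjointness already confines the spectrum to the real line, so only negative real
  points remain to be tested.\<close>

lemma cstar_positive_iff:
  "cstar_positive h \<longleftrightarrow> star h = h \<and> (\<forall>r<0. invertible_elem (h - r *\<^sub>R 1))"
proof (cases "star h = h")
  case True
  have "algebra_spectrum h \<subseteq> \<real>\<^sub>\<ge>\<^sub>0 \<longleftrightarrow> (\<forall>r<0. invertible_elem (h - r *\<^sub>R 1))"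
  proof
    assume *: "algebra_spectrum h \<subseteq> \<real>\<^sub>\<ge>\<^sub>0"
    show "\<forall>r<0. invertible_elem (h - r *\<^sub>R 1)"
    proof (intro allI impI)
      fix r :: real assume "r < 0"
      then have "complex_of_real r \<notin> algebra_spectrum h" using * by auto
      then show "invertible_elem (h - r *\<^sub>R 1)" by (simp add: algebra_spectrum_iff scaleC_of_real)
    qed
  next
    assume *: "\<forall>r<0. invertible_elem (h - r *\<^sub>R 1)"
    show "algebra_spectrum h \<subseteq> \<real>\<^sub>\<ge>\<^sub>0"
    proof
      fix c assume c: "c \<in> algebra_spectrum h"
      have "Im c = 0" using spectrum_selfadjoint_real[OF True] c algebra_spectrum_iff by blast
      then have c': "c = of_real (Re c)" by (simp add: complex_eq_iff)
      then have "\<not> invertible_elem (h - Re c *\<^sub>R 1)"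
        using c by (metis algebra_spectrum_iff scaleC_of_real)
      then have "Re c \<ge> 0" using * not_le by blast
      then show "c \<in> \<real>\<^sub>\<ge>\<^sub>0" using c' by (metis nonneg_Reals_of_real_iff)
    qed
  qed
  then show ?thesis using True by (simp add: cstar_positive_def)
qed (simp add: cstar_positive_def)

section \<open>The norm criterion for positivity and the order structure of the cone\<close>

lemma cstar_positiveD:
  assumes "cstar_positive h"
  shows "star h = h" "r < 0 \<Longrightarrow> invertible_elem (h - r *\<^sub>R 1)"
  using assms by (auto simp: cstar_positive_iff)

text \<open>The spectrum of t - h lies in the disc of radius \<open>t\<close>, so that of
  \<open>h\<close> has no point below 0. Any \<open>t\<close> will do here, which leaves it free in
  the applications.\<close>

lemma cstar_positive_if_norm:
  fixes h :: "'a::unital_cstar_algebra"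
  assumes "star h = h" "norm (t *\<^sub>R 1 - h) \<le> t"
  shows "cstar_positive h"
  unfolding cstar_positive_iff
proof (intro conjI allI impI)
  fix r :: real assume r: "r < 0"
  have "invertible_elem ((t *\<^sub>R 1 - h) - (t - r) *\<^sub>R 1)"
    using assms(2) r by (intro invertible_elem_norm_less_real) linarith
  also have "(t *\<^sub>R 1 - h) - (t - r) *\<^sub>R 1 = - (h - r *\<^sub>R 1)" by (simp add: algebra_simps)
  finally show "invertible_elem (h - r *\<^sub>R 1)" by (simp only: invertible_elem_minus)
qed (fact assms)

text \<open>The converse needs the spectral radius: for \<open>t\<close> at least the norm, the
  spectrum of t - h lies in [0, t], and \<open>norm_le_of_spectrum\<close> turns this into a norm
  bound.\<close>

lemma norm_if_cstar_positive:
  fixes h :: "'a::unital_cstar_algebra"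
  assumes "cstar_positive h" "norm h \<le> t"
  shows "norm (t *\<^sub>R 1 - h) \<le> t"
proof (rule norm_le_of_spectrum)
  show "star (t *\<^sub>R 1 - h) = t *\<^sub>R 1 - h"
    using cstar_positiveD(1)[OF assms(1)] by (simp add: star_diff star_scaleR)
  show t: "t \<ge> 0" using assms(2) norm_ge_zero order_trans by blast
  fix r assume r: "\<bar>r\<bar> > t"
  have "invertible_elem (h - (t - r) *\<^sub>R 1)"
  proof (cases "t - r < 0")
    case True
    then show ?thesis using cstar_positiveD(2)[OF assms(1)] by blast
  next
    case False
    then show ?thesis using assms(2) r t by (intro invertible_elem_norm_less_real) linarith
  qed
  also have "h - (t - r) *\<^sub>R 1 = - ((t *\<^sub>R 1 - h) - r *\<^sub>R 1)" by (simp add: algebra_simps)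
  finally show "invertible_elem ((t *\<^sub>R 1 - h) - r *\<^sub>R 1)" by (simp only: invertible_elem_minus)
qed

text \<open>With t the sum of the norms, the norm criterion is just the triangle inequality.\<close>

lemma cstar_positive_add:
  assumes "cstar_positive a" "cstar_positive b"
  shows "cstar_positive (a + b)"
proof (rule cstar_positive_if_norm)
  show "star (a + b) = a + b"
    using assms by (simp add: star_add cstar_positiveD(1))
  have "(norm a + norm b) *\<^sub>R 1 - (a + b) = (norm a *\<^sub>R 1 - a) + (norm b *\<^sub>R 1 - b)"
    by (simp add: algebra_simps)
  then show "norm ((norm a + norm b) *\<^sub>R 1 - (a + b)) \<le> norm a + norm b"
    using norm_triangle_mono[OF norm_if_cstar_positive[OF assms(1) order_refl]
        norm_if_cstar_positive[OF assms(2) order_refl]] by (simp only:)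
qed

lemma cstar_positive_scaleR:
  assumes "cstar_positive a" "r \<ge> 0"
  shows "cstar_positive (r *\<^sub>R a)"
proof (rule cstar_positive_if_norm)
  show "star (r *\<^sub>R a) = r *\<^sub>R a"
    using assms by (simp add: star_scaleR cstar_positiveD(1))
  have "(r * norm a) *\<^sub>R 1 - r *\<^sub>R a = r *\<^sub>R (norm a *\<^sub>R 1 - a)"
    by (simp add: algebra_simps)
  then show "norm ((r * norm a) *\<^sub>R 1 - r *\<^sub>R a) \<le> r * norm a"
    using norm_if_cstar_positive[OF assms(1) order_refl] assms(2) by (simp add: mult_left_mono)
qed

lemma cstar_positive_zero [simp]: "cstar_positive 0"
  by (rule cstar_positive_if_norm[of _ 0]) simp_all

lemma cstar_positive_sum:
  "(\<And>i. i \<in> F \<Longrightarrow> cstar_positive (f i)) \<Longrightarrow> cstar_positive (sum f F)"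
  by (induction F rule: infinite_finite_induct) (simp_all add: cstar_positive_add)

text \<open>A convergent sequence is bounded, so one common \<open>t\<close> serves all its terms;
  for fixed \<open>t\<close> the norm criterion is a closed condition.\<close>

lemma cstar_positive_LIMSEQ:
  assumes "X \<longlonglongrightarrow> a" "\<And>n. cstar_positive (X n)"
  shows "cstar_positive a"
proof -
  obtain t where t: "\<And>n. norm (X n) \<le> t"
    using convergent_imp_Bseq[OF convergentI[OF assms(1)]] by (auto simp: Bseq_def)
  show ?thesis
  proof (rule cstar_positive_if_norm)
    have "(\<lambda>n. star (X n)) \<longlonglongrightarrow> star a"
      by (rule bounded_linear.tendsto[OF bounded_linear_star assms(1)])
    then have "X \<longlonglongrightarrow> star a"
      using cstar_positiveD(1)[OF assms(2)] by simp
    then show "star a = a" using assms(1) LIMSEQ_unique by blast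
    have "(\<lambda>n. norm (t *\<^sub>R 1 - X n)) \<longlonglongrightarrow> norm (t *\<^sub>R 1 - a)"
      by (intro tendsto_intros assms)
    then show "norm (t *\<^sub>R 1 - a) \<le> t"
      by (rule LIMSEQ_le_const2) (use norm_if_cstar_positive[OF assms(2) t] in blast)
  qed
qed

lemma cstar_positive_suminf:
  assumes "summable f" "\<And>n. cstar_positive (f n)"
  shows "cstar_positive (suminf f)"
  by (rule cstar_positive_LIMSEQ[OF summable_LIMSEQ[OF assms(1)]])
     (simp add: cstar_positive_sum assms(2))

lemma cstar_positive_norm_minus:
  assumes "star h = h" "norm h \<le> t"
  shows "cstar_positive (t *\<^sub>R 1 - h)"
  by (rule cstar_positive_if_norm[of _ t]) (use assms in \<open>simp_all add: star_diff star_scaleR\<close>)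

text \<open>Writing norm b - a as (norm b - b) + (b - a) shows that it is positive, which confines
  the spectrum of \<open>a\<close> to [0, norm b].\<close>

lemma cstar_positive_norm_mono:
  assumes "cstar_positive a" "cstar_positive (b - a)"
  shows "norm a \<le> norm b"
proof (rule norm_le_of_spectrum)
  show sa: "star a = a" using assms(1) by (rule cstar_positiveD)
  have "star (b - a + a) = b - a + a"
    by (subst star_add) (simp only: cstar_positiveD(1)[OF assms(2)] sa)
  then have "star b = b" by simp
  then have "cstar_positive ((norm b *\<^sub>R 1 - b) + (b - a))"
    by (intro cstar_positive_add assms cstar_positive_norm_minus) auto
  then have p: "cstar_positive (norm b *\<^sub>R 1 - a)" by simp
  fix r assume r: "\<bar>r\<bar> > norm b"
  show "invertible_elem (a - r *\<^sub>R 1)"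
  proof (cases "r < 0")
    case True
    then show ?thesis using assms(1) by (simp add: cstar_positiveD)
  next
    case False
    then have "invertible_elem ((norm b *\<^sub>R 1 - a) - (norm b - r) *\<^sub>R 1)"
      using r by (intro cstar_positiveD[OF p]) auto
    also have "(norm b *\<^sub>R 1 - a) - (norm b - r) *\<^sub>R 1 = - (a - r *\<^sub>R 1)"
      by (simp add: algebra_simps)
    finally show ?thesis by (simp only: invertible_elem_minus)
  qed
qed simp

lemma cstar_positive_norm_le:
  assumes "t \<ge> 0" "star h = h" "cstar_positive (t *\<^sub>R 1 - h)" "cstar_positive (t *\<^sub>R 1 + h)"
  shows "norm h \<le> t"
proof (rule norm_le_of_spectrum)
  fix r assume r: "\<bar>r\<bar> > t"
  show "invertible_elem (h - r *\<^sub>R 1)"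
  proof (cases "r < 0")
    case True
    have "invertible_elem ((t *\<^sub>R 1 + h) - (t + r) *\<^sub>R 1)"
      using r True by (intro cstar_positiveD[OF assms(4)]) auto
    then show ?thesis by (simp add: algebra_simps)
  next
    case False
    have "invertible_elem ((t *\<^sub>R 1 - h) - (t - r) *\<^sub>R 1)"
      using r False by (intro cstar_positiveD[OF assms(3)]) auto
    also have "(t *\<^sub>R 1 - h) - (t - r) *\<^sub>R 1 = - (h - r *\<^sub>R 1)" by (simp add: algebra_simps)
    finally show ?thesis by (simp only: invertible_elem_minus)
  qed
qed (use assms in auto)

text \<open>Over the complex numbers the polynomial splits, and a noninvertible product has a
  noninvertible factor. Degree two is all that the later arguments require.\<close>

lemma spectral_mapping_quadratic:
  fixes h :: "'a::unital_cstar_algebra"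
  assumes "\<alpha> \<noteq> 0 \<or> \<beta> \<noteq> 0" "\<not> invertible_elem (\<alpha> *\<^sub>C (h * h) + \<beta> *\<^sub>C h + \<gamma> *\<^sub>C 1)"
  shows "\<exists>c. \<alpha> * c\<^sup>2 + \<beta> * c + \<gamma> = 0 \<and> \<not> invertible_elem (h - c *\<^sub>C 1)"
proof (cases "\<alpha> = 0")
  case True
  then have \<beta>: "\<beta> \<noteq> 0" using assms by auto
  have "\<alpha> *\<^sub>C (h * h) + \<beta> *\<^sub>C h + \<gamma> *\<^sub>C 1 = \<beta> *\<^sub>C (h - (- \<gamma> / \<beta>) *\<^sub>C 1)"
    using \<beta> True by (simp add: scaleC_diff_right scaleC_add_right scaleC_scaleC scaleC_minus_left)
  then have "\<not> invertible_elem (h - (- \<gamma> / \<beta>) *\<^sub>C 1)"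
    using assms(2) invertible_elem_scaleC[OF \<beta>] by metis
  then show ?thesis using True \<beta> by (intro exI[of _ "- \<gamma> / \<beta>"]) simp
next
  case False
  define s where "s = csqrt (\<beta>\<^sup>2 - 4 * \<alpha> * \<gamma>)"
  have s: "s * s = \<beta>\<^sup>2 - 4 * \<alpha> * \<gamma>" by (simp add: s_def flip: power2_eq_square)
  define c d where "c = (- \<beta> + s) / (2 * \<alpha>)" and "d = (- \<beta> - s) / (2 * \<alpha>)"
  have "\<gamma> = (\<beta>\<^sup>2 - s * s) / (4 * \<alpha>)" using False s by (simp add: field_simps)
  moreover have "\<alpha> * (c * d) = (\<beta>\<^sup>2 - s * s) / (4 * \<alpha>)"
    using False by (simp add: c_def d_def field_simps power2_eq_square)
  moreover have "\<alpha> * (c + d) = - \<beta>"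
    using False by (simp add: c_def d_def field_simps)
  ultimately have cd: "\<alpha> * (c + d) = - \<beta>" "\<alpha> * (c * d) = \<gamma>" by simp_all
  have \<beta>: "\<beta> = - (\<alpha> * (c + d))" using cd(1) by simp
  have roots: "\<alpha> * c\<^sup>2 + \<beta> * c + \<gamma> = 0" "\<alpha> * d\<^sup>2 + \<beta> * d + \<gamma> = 0"
    by (simp_all add: \<beta> cd(2)[symmetric] algebra_simps power2_eq_square)
  have "\<alpha> *\<^sub>C ((h - c *\<^sub>C 1) * (h - d *\<^sub>C 1))
      = \<alpha> *\<^sub>C (h * h) - (\<alpha> * (c + d)) *\<^sub>C h + (\<alpha> * (c * d)) *\<^sub>C 1"
    by (simp add: algebra_simps scaleC_diff_right scaleC_add_right scaleC_mult_left
        scaleC_mult_right scaleC_scaleC scaleC_add_left)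
  then have "\<alpha> *\<^sub>C (h * h) + \<beta> *\<^sub>C h + \<gamma> *\<^sub>C 1 = \<alpha> *\<^sub>C ((h - c *\<^sub>C 1) * (h - d *\<^sub>C 1))"
    unfolding cd by (simp add: scaleC_minus_left)
  then have "\<not> invertible_elem ((h - c *\<^sub>C 1) * (h - d *\<^sub>C 1))"
    using assms(2) invertible_elem_scaleC[OF False] by metis
  then have "\<not> invertible_elem (h - c *\<^sub>C 1) \<or> \<not> invertible_elem (h - d *\<^sub>C 1)"
    using invertible_elem_mult(1) by blast
  then show ?thesis using roots by blast
qed

lemma spectral_mapping_quadratic_real:
  fixes h :: "'a::unital_cstar_algebra"
  assumes "star h = h" "\<alpha> \<noteq> 0 \<or> \<beta> \<noteq> 0"
    "\<not> invertible_elem (\<alpha> *\<^sub>R (h * h) + \<beta> *\<^sub>R h + \<gamma> *\<^sub>R 1)"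
  shows "\<exists>x. \<alpha> * x\<^sup>2 + \<beta> * x + \<gamma> = 0 \<and> \<not> invertible_elem (h - x *\<^sub>R 1)"
proof -
  obtain c where c: "of_real \<alpha> * c\<^sup>2 + of_real \<beta> * c + of_real \<gamma> = 0"
    "\<not> invertible_elem (h - c *\<^sub>C 1)"
    using spectral_mapping_quadratic[of "of_real \<alpha>" "of_real \<beta>" h "of_real \<gamma>"] assms(2,3)
    by (auto simp: scaleC_of_real)
  then have "Im c = 0" using spectrum_selfadjoint_real[OF assms(1)] by blast
  then have c': "c = of_real (Re c)" by (simp add: complex_eq_iff)
  have "of_real (\<alpha> * (Re c)\<^sup>2 + \<beta> * Re c + \<gamma>) = (0::complex)"
    using c(1) c' by (metis of_real_add of_real_mult of_real_power)
  then have "\<alpha> * (Re c)\<^sup>2 + \<beta> * Re c + \<gamma> = 0" by (simp only: of_real_eq_0_iff)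
  moreover have "\<not> invertible_elem (h - Re c *\<^sub>R 1)"
    using c(2) c' by (metis scaleC_of_real)
  ultimately show ?thesis by blast
qed

section \<open>Positivity of \<open>star a * a\<close> and of conjugates of positive
  elements\<close>

lemma cstar_positive_square:
  assumes "star h = h"
  shows "cstar_positive (h * h)"
  unfolding cstar_positive_iff
proof (intro conjI allI impI)
  fix r :: real assume "r < 0"
  show "invertible_elem (h * h - r *\<^sub>R 1)"
  proof (rule ccontr)
    assume "\<not> invertible_elem (h * h - r *\<^sub>R 1)"
    then have "\<exists>x. 1 * x\<^sup>2 + 0 * x + (- r) = 0 \<and> \<not> invertible_elem (h - x *\<^sub>R 1)"
      using assms by (intro spectral_mapping_quadratic_real) auto
    then show False using \<open>r < 0\<close> by auto
  qed
qed (simp add: star_mult assms)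

text \<open>Jacobson's lemma: the inverse of 1 - b a is 1 + b c a, where c inverts 1 - a b, as the
  formal geometric series suggests.\<close>

lemma invertible_elem_one_minus_swap:
  fixes a b :: "'a::ring_1"
  assumes "invertible_elem (1 - a * b)"
  shows "invertible_elem (1 - b * a)"
proof -
  let ?c = "elem_inv (1 - a * b)"
  have c: "?c = 1 + a * b * ?c" "?c = 1 + ?c * a * b"
    using elem_inv[OF assms] by (simp_all add: algebra_simps)
  show ?thesis
  proof (rule invertible_elemI)
    have "(1 - b * a) * (1 + b * ?c * a) = 1 - b * a + b * (?c - a * b * ?c) * a"
      by (simp add: algebra_simps)
    also have "?c - a * b * ?c = 1" using c(1) by (simp add: algebra_simps)
    finally show "(1 - b * a) * (1 + b * ?c * a) = 1" by simp
    have "(1 + b * ?c * a) * (1 - b * a) = 1 - b * a + b * (?c - ?c * a * b) * a"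
      by (simp add: algebra_simps)
    also have "?c - ?c * a * b = 1" using c(2) by (simp add: algebra_simps)
    finally show "(1 + b * ?c * a) * (1 - b * a) = 1" by simp
  qed
qed

lemma spectrum_swap:
  fixes a b :: "'a::unital_cstar_algebra"
  assumes "r \<noteq> 0" "invertible_elem (a * b - r *\<^sub>R 1)"
  shows "invertible_elem (b * a - r *\<^sub>R 1)"
proof -
  have eq: "u * v - r *\<^sub>R 1 = (- r) *\<^sub>R (1 - ((1 / r) *\<^sub>R u) * v)" for u v :: 'a
    using assms(1) by (simp add: algebra_simps)
  have "invertible_elem (1 - ((1 / r) *\<^sub>R a) * b)"
    using assms(2) unfolding eq[of a b] using assms(1) by (subst (asm) invertible_elem_scaleR) auto
  then have "invertible_elem (1 - b * ((1 / r) *\<^sub>R a))"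
    by (rule invertible_elem_one_minus_swap)
  then show ?thesis
    unfolding eq[of b a] using assms(1) by (subst invertible_elem_scaleR) simp_all
qed

text \<open>
  An upper bound on c* c passes to c c*, and c* c + c c* is a sum of two squares of
  self-adjoint elements; so the upper bound is automatically a lower bound as well.
\<close>

lemma norm_star_mult_le:
  fixes c :: "'a::unital_cstar_algebra"
  assumes "\<delta> \<ge> 0" "cstar_positive (\<delta> *\<^sub>R 1 - star c * c)"
  shows "norm (star c * c) \<le> \<delta>"
proof (rule cstar_positive_norm_le[OF assms(1) _ assms(2)])
  show "star (star c * c) = star c * c" by (simp add: star_mult star_star)
  have "cstar_positive (\<delta> *\<^sub>R 1 - c * star c)"
    unfolding cstar_positive_iff
  proof (intro conjI allI impI)
    fix r :: real assume r: "r < 0"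
    have "invertible_elem ((\<delta> *\<^sub>R 1 - star c * c) - r *\<^sub>R 1)"
      using cstar_positiveD(2)[OF assms(2) r] .
    moreover have "(\<delta> *\<^sub>R 1 - u) - r *\<^sub>R 1 = - (u - (\<delta> - r) *\<^sub>R 1)" for u :: 'a
      by (simp add: algebra_simps)
    ultimately have "invertible_elem (star c * c - (\<delta> - r) *\<^sub>R 1)"
      by (simp only: invertible_elem_minus)
    then have "invertible_elem (c * star c - (\<delta> - r) *\<^sub>R 1)"
      by (rule spectrum_swap[rotated]) (use assms(1) r in simp)
    then show "invertible_elem ((\<delta> *\<^sub>R 1 - c * star c) - r *\<^sub>R 1)"
      unfolding \<open>\<And>u. (\<delta> *\<^sub>R 1 - u) - r *\<^sub>R 1 = - (u - (\<delta> - r) *\<^sub>R 1)\<close> invertible_elem_minus .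
  qed (simp add: star_diff star_scaleR star_mult star_star)
  \<comment> \<open>Twice the real part of \<open>c\<close> and minus twice its imaginary part; half
    the sum of their squares is c c* + c* c. Adding \<delta> - c c* then leaves the lower
    bound.\<close>
  moreover define x y where "x = c + star c" and "y = \<i> *\<^sub>C (c - star c)"
  have "star x = x" "star y = y"
    by (simp_all add: x_def y_def star_add star_star star_scaleC star_diff scaleC_minus_left
        scaleC_diff_right add.commute)
  then have "cstar_positive ((1/2) *\<^sub>R (x * x + y * y))"
    by (intro cstar_positive_scaleR cstar_positive_add cstar_positive_square) auto
  ultimately have "cstar_positive ((1/2) *\<^sub>R (x * x + y * y) + (\<delta> *\<^sub>R 1 - c * star c))"
    by (rule cstar_positive_add[rotated])
  also have "(1/2) *\<^sub>R (x * x + y * y) = c * star c + star c * c"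
  proof -
    have "y * y = - ((c - star c) * (c - star c))"
      by (simp add: y_def scaleC_mult_left scaleC_mult_right scaleC_scaleC scaleC_minus_left scaleC_one)
    then have "x * x + y * y = 2 *\<^sub>R (c * star c + star c * c)"
      by (simp add: x_def scaleR_2) (simp add: algebra_simps)
    then show ?thesis by simp
  qed
  finally show "cstar_positive (\<delta> *\<^sub>R 1 + star c * c)" by (simp add: algebra_simps)
qed

text \<open>
  With h = a* a and d = (h + 1 - i)^(-1), the element c = a d has c* c = h / ((h+1)^2 + 1),
  a function that is at most 1/4 on the real line but takes the value -1 at -1; by the
  previous lemma its norm is at most 1/4, so -1 cannot be a spectral value of h.
\<close>

lemma invertible_elem_star_mult_plus_one:
  fixes a :: "'a::unital_cstar_algebra"
  shows "invertible_elem (star a * a + 1)"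
proof -
  define h where "h = star a * a"
  have sh: "star h = h" by (simp add: h_def star_mult star_star)
  \<comment> \<open>The two conjugate factors of (h + 1)^2 + 1; they are invertible because their
    roots -1 + i and -1 - i are not real.\<close>
  define m m' where "m = h + (1 - \<i>) *\<^sub>C 1" and "m' = h + (1 + \<i>) *\<^sub>C 1"
  have sm: "star m = m'" by (simp add: m_def m'_def star_add star_scaleC sh)
  have mm: "m' * m = h * h + 2 *\<^sub>R h + 2 *\<^sub>R 1"
    by (simp add: m_def m'_def algebra_simps scaleC_mult_left scaleC_mult_right scaleC_scaleC
        scaleC_add_left scaleC_diff_left scaleC_minus_left scaleC_one scaleC_add_right scaleC_diff_right
        scaleR_2)
  have im: "invertible_elem m"
    using spectrum_selfadjoint_real[OF sh, of "\<i> - 1"]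
    by (simp add: m_def scaleC_diff_left algebra_simps)
  define d where "d = elem_inv m"
  have d: "m * d = 1" "d * m = 1" using elem_inv[OF im] by (simp_all add: d_def)
  have d': "star d * m' = 1" "m' * star d = 1"
    using d sm by (metis star_mult star_one)+
  have id: "invertible_elem d" "invertible_elem (star d)"
    using d d' by (auto intro: invertible_elemI)
  define q where "q = star d * h * d"
  have q: "q = star (a * d) * (a * d)"
    by (simp add: q_def h_def star_mult mult.assoc)
  have conj: "star d * (m' * m) * d = 1"
    using d d' by (metis mult.assoc mult_1_left)
  have "norm q \<le> 1/4"
    unfolding q
  proof (rule norm_star_mult_le)
    show "cstar_positive ((1/4) *\<^sub>R 1 - star (a * d) * (a * d))"
      unfolding cstar_positive_iff q[symmetric]
    proof (intro conjI allI impI)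
      show "star ((1/4) *\<^sub>R 1 - q) = (1/4) *\<^sub>R 1 - q"
        by (simp add: q star_diff star_scaleR star_mult star_star)
      fix r :: real assume r: "r < 0"
      define s where "s = 1/4 - r"
      have s: "s > 1/4" using r by (simp add: s_def)
      have "(1/4) *\<^sub>R 1 - q - r *\<^sub>R 1 = s *\<^sub>R (star d * (m' * m) * d) - q"
        unfolding conj by (simp add: s_def algebra_simps)
      also have "\<dots> = star d * (s *\<^sub>R (m' * m) - h) * d"
        by (simp add: q_def algebra_simps)
      also have "s *\<^sub>R (m' * m) - h = s *\<^sub>R (h * h) + (2 * s - 1) *\<^sub>R h + (2 * s) *\<^sub>R 1"
        unfolding mm by (simp add: algebra_simps)
      finally have eq: "(1/4) *\<^sub>R 1 - q - r *\<^sub>R 1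
        = star d * (s *\<^sub>R (h * h) + (2 * s - 1) *\<^sub>R h + (2 * s) *\<^sub>R 1) * d" .
      \<comment> \<open>A real root would satisfy s ((x + 1)^2 + 1) = x with s > 1/4, hence (x +
        1)^2 + 1 <= 4 x, that is (x - 1)^2 + 1 <= 0.\<close>
      have "invertible_elem (s *\<^sub>R (h * h) + (2 * s - 1) *\<^sub>R h + (2 * s) *\<^sub>R 1)"
      proof (rule ccontr)
        assume "\<not> ?thesis"
        then obtain x where "s * x\<^sup>2 + (2 * s - 1) * x + 2 * s = 0"
          using spectral_mapping_quadratic_real[OF sh, of s "2 * s - 1" "2 * s"] s by auto
        then have "s * ((x + 1)\<^sup>2 + 1) = x" by (simp add: algebra_simps power2_eq_square)
        moreover have "s * ((x + 1)\<^sup>2 + 1) \<ge> (1/4) * ((x + 1)\<^sup>2 + 1)"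
          using s by (intro mult_right_mono) auto
        ultimately have "(x - 1)\<^sup>2 + 1 \<le> 0" by (simp add: power2_eq_square algebra_simps)
        then show False by (smt (verit) zero_le_power2)
      qed
      then show "invertible_elem ((1/4) *\<^sub>R 1 - q - r *\<^sub>R 1)"
        unfolding eq by (intro invertible_elem_mult id)
    qed
  qed simp
  \<comment> \<open>The numerator of 1 + q is (h + 1)^2 + 1 + h = (h + 1)(h + 2), which contains the
    factor to be inverted.\<close>
  then have "invertible_elem (1 - (- q))" by (intro neumann_series(1)) simp
  also have "1 - (- q) = star d * (m' * m) * d + star d * h * d"
    by (simp add: conj q_def)
  also have "\<dots> = star d * (((h + 1) * (h + 2 *\<^sub>R 1)) * d)"
    unfolding mm by (simp add: algebra_simps scaleR_2 mult_2)
  finally have "invertible_elem (((h + 1) * (h + 2 *\<^sub>R 1)) * d)"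
    using id(2) by (simp add: invertible_elem_mult_left_iff)
  then have "invertible_elem ((((h + 1) * (h + 2 *\<^sub>R 1)) * d) * m)"
    using im by (rule invertible_elem_mult)
  then have "invertible_elem ((h + 1) * (h + 2 *\<^sub>R 1))"
    using d by (simp add: mult.assoc)
  moreover have "(h + 1) * (h + 2 *\<^sub>R 1) = (h + 2 *\<^sub>R 1) * (h + 1)"
    by (simp add: algebra_simps scaleR_2 mult_2 mult_2_right)
  ultimately show ?thesis unfolding h_def[symmetric] by (rule invertible_elem_mult_commute[rotated])
qed

lemma cstar_positive_star_mult: "cstar_positive (star a * a)"
  unfolding cstar_positive_iff
proof (intro conjI allI impI)
  fix r :: real assume r: "r < 0"
  \<comment> \<open>Rescaling moves the spectral point r to -1.\<close>
  define b where "b = (1 / sqrt (- r)) *\<^sub>R a"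
  have "star b * b = (1 / (- r)) *\<^sub>R (star a * a)"
    using r by (simp add: b_def star_scaleR)
  then have "star b * b + 1 = (1 / (- r)) *\<^sub>R (star a * a - r *\<^sub>R 1)"
    using r by (simp add: scaleR_diff_right)
  then have "invertible_elem ((1 / (- r)) *\<^sub>R (star a * a - r *\<^sub>R 1))"
    using invertible_elem_star_mult_plus_one[of b] by simp
  then show "invertible_elem (star a * a - r *\<^sub>R 1)"
    using r by (subst (asm) invertible_elem_scaleR) auto
qed (simp add: star_mult star_star)

lemma cstar_positive_mult_star: "cstar_positive (a * star a)"
  using cstar_positive_star_mult[of "star a"] by (simp add: star_star)

text \<open>
  The iteration x \<mapsto> x - x^2 writes a positive p of norm at most 1 as the sum of the squares
  of its iterates, which replaces a square root of p.
\<close>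

lemma cstar_positive_conj:
  assumes "cstar_positive p"
  shows "cstar_positive (b * p * star b)"
proof -
  have *: "cstar_positive (b * p * star b)" if p: "cstar_positive p" "norm p \<le> 1" for p
  proof -
    define x where "x = rec_nat p (\<lambda>_ y. y - y * y)"
    have x0: "x 0 = p" and xS: "\<And>n. x (Suc n) = x n - x n * x n"
      by (simp_all add: x_def)
    \<comment> \<open>The map y - y^2 sends [0, 1/(n+1)] into [0, 1/(n+2)], and spectral mapping
      transfers this to the iterates; so they tend to 0 in norm.\<close>
    have x: "cstar_positive (x n) \<and> norm (x n) \<le> 1 / (real n + 1)" for n
    proof (induction n)
      case 0
      then show ?case using p by (simp add: x0)
    next
      case (Suc n)
      have sx: "star (x n) = x n" using Suc cstar_positiveD by blast
      then have sS: "star (x (Suc n)) = x (Suc n)" by (simp add: xS star_diff star_mult)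
      have I: "invertible_elem (x (Suc n) - r *\<^sub>R 1)" if r: "r < 0 \<or> r > 1 / (real (Suc n) + 1)" for r
      proof (rule ccontr)
        assume "\<not> ?thesis"
        then have "\<not> invertible_elem ((- 1) *\<^sub>R (x n * x n) + 1 *\<^sub>R x n + (- r) *\<^sub>R 1)"
          by (simp add: xS)
        then obtain y where y: "(- 1) * y\<^sup>2 + 1 * y + (- r) = 0" "\<not> invertible_elem (x n - y *\<^sub>R 1)"
          using spectral_mapping_quadratic_real[OF sx] by (metis zero_neq_one)
        have "y \<ge> 0" using y(2) Suc cstar_positiveD(2) not_le by blast
        moreover have "\<bar>y\<bar> \<le> norm (x n)" using y(2) invertible_elem_norm_less_real by force
        ultimately have y01: "0 \<le> y" "y \<le> 1 / (real n + 1)" using Suc by auto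
        have ry: "r = y - y\<^sup>2" using y(1) by simp
        have "y\<^sup>2 \<le> y"
        proof -
          have "1 / (real n + 1) \<le> 1" by simp
          then have "y \<le> 1" using y01 by linarith
          then show ?thesis using y01 by (simp add: power2_eq_square mult_left_le)
        qed
        moreover have "y - y\<^sup>2 \<le> 1 / (real (Suc n) + 1)"
        proof -
          have "y * (real n + 1) \<le> 1" using y01 by (simp add: field_simps)
          then have "(y - y\<^sup>2) * (real n + 2) \<le> 1"
          proof -
            have "1 - (y - y\<^sup>2) * (real n + 2) = (1 - y) * (1 - y * (real n + 1)) + y\<^sup>2"
              by (simp add: power2_eq_square algebra_simps)
            moreover have "(1 - y) * (1 - y * (real n + 1)) \<ge> 0"
            proof (rule mult_nonneg_nonneg)
              have "1 / (real n + 1) \<le> 1" by simp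
              then show "0 \<le> 1 - y" using y01 by linarith
            qed (use \<open>y * (real n + 1) \<le> 1\<close> in simp)
            ultimately show ?thesis by (smt (verit) zero_le_power2)
          qed
          then show ?thesis by (simp add: field_simps)
        qed
        ultimately show False using r ry by linarith
      qed
      show ?case
      proof
        show "cstar_positive (x (Suc n))" unfolding cstar_positive_iff using sS I by blast
        show "norm (x (Suc n)) \<le> 1 / (real (Suc n) + 1)"
        proof (rule norm_le_of_spectrum[OF sS])
          fix r assume "\<bar>r\<bar> > 1 / (real (Suc n) + 1)"
          then have "r < 0 \<or> r > 1 / (real (Suc n) + 1)" by linarith
          then show "invertible_elem (x (Suc n) - r *\<^sub>R 1)" by (rule I)
        qed simp
      qed
    qed
    \<comment> \<open>Each term is b x_n^2 b*, and x_n^2 = x_n - x_(n+1) makes the sum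
      telescope.\<close>
    have tel: "(\<Sum>n<N. (b * x n) * star (b * x n)) = b * p * star b - b * x N * star b" for N
    proof (induction N)
      case (Suc N)
      have "(b * x N) * star (b * x N) = b * x N * star b - b * x (Suc N) * star b"
        using cstar_positiveD(1)[of "x N"] x by (simp add: xS star_mult algebra_simps)
      then show ?case using Suc by simp
    qed (simp add: x0)
    have "x \<longlonglongrightarrow> 0"
    proof (rule Lim_null_comparison)
      show "eventually (\<lambda>n. norm (x n) \<le> 1 / (real n + 1)) sequentially" using x by simp
      show "(\<lambda>n. 1 / (real n + 1)) \<longlonglongrightarrow> 0"
        using LIMSEQ_inverse_real_of_nat by (simp add: inverse_eq_divide add.commute)
    qed
    then have "(\<lambda>N. b * p * star b - b * x N * star b) \<longlonglongrightarrow> b * p * star b - b * 0 * star b"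
      by (intro tendsto_intros)
    then have "(\<lambda>N. \<Sum>n<N. (b * x n) * star (b * x n)) \<longlonglongrightarrow> b * p * star b"
      by (simp add: tel)
    then show ?thesis
      by (rule cstar_positive_LIMSEQ) (intro cstar_positive_sum cstar_positive_mult_star)
  qed
  define k where "k = 1 / (norm p + 1)"
  have "norm p + 1 > 0" by (smt (verit) norm_ge_zero)
  then have k: "k > 0" "norm (k *\<^sub>R p) \<le> 1" by (simp_all add: k_def)
  have "cstar_positive (b * (k *\<^sub>R p) * star b)"
    by (intro * k(2) cstar_positive_scaleR[OF assms]) (use k in simp)
  then have "cstar_positive ((1 / k) *\<^sub>R (b * (k *\<^sub>R p) * star b))"
    using k by (intro cstar_positive_scaleR) auto
  then show ?thesis using k by simp
qed

text \<open>Read p, q, a as <x,x>, <y,y>, <x,y>; the hypothesis is then positivity of <x - b y, x -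
  b y>. The abstract form serves the inner product, finite sums in the algebra, and the semidefinite
  form <B x, y>. The choice b = a / N with N above \<open>norm q\<close> covers q = 0 as well; N
  tends to \<open>norm q\<close> at the end.\<close>

lemma cstar_cauchy_schwarz:
  fixes p q a :: "'a::unital_cstar_algebra"
  assumes pos: "\<And>b. cstar_positive (p - b * star a - a * star b + b * q * star b)"
    and q: "star q = q"
  shows "(norm a)\<^sup>2 \<le> norm p * norm q"
proof -
  have *: "(norm a)\<^sup>2 \<le> norm p * N" if N: "N > norm q" for N
  proof -
    have N0: "N > 0" using N norm_ge_zero[of q] by linarith
    let ?a = "a * star a"
    have 1: "cstar_positive (p - (2 / N) *\<^sub>R ?a + (1 / N\<^sup>2) *\<^sub>R (a * q * star a))"
      using pos[of "(1 / N) *\<^sub>R a"] N0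
      by (simp add: star_scaleR power2_eq_square scaleR_2[symmetric] diff_diff_eq
          flip: scaleR_add_left)
    have 2: "cstar_positive ((1 / N\<^sup>2) *\<^sub>R (a * (norm q *\<^sub>R 1 - q) * star a))"
      by (intro cstar_positive_scaleR cstar_positive_conj cstar_positive_norm_minus q) auto
    \<comment> \<open>Fills the gap between \<open>norm q\<close> and N, so that the coefficients of
      \<open>?a\<close> add up to exactly -1/N.\<close>
    have 3: "cstar_positive (((N - norm q) / N\<^sup>2) *\<^sub>R ?a)"
      using N by (intro cstar_positive_scaleR cstar_positive_mult_star) auto
    have "(1 / N\<^sup>2) *\<^sub>R (a * (norm q *\<^sub>R 1 - q) * star a)
        = (norm q / N\<^sup>2) *\<^sub>R ?a - (1 / N\<^sup>2) *\<^sub>R (a * q * star a)"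
      by (simp add: algebra_simps)
    then have "(p - (2 / N) *\<^sub>R ?a + (1 / N\<^sup>2) *\<^sub>R (a * q * star a))
        + (1 / N\<^sup>2) *\<^sub>R (a * (norm q *\<^sub>R 1 - q) * star a) + ((N - norm q) / N\<^sup>2) *\<^sub>R ?a
        = p + (- (2 / N) + norm q / N\<^sup>2 + (N - norm q) / N\<^sup>2) *\<^sub>R ?a"
      by (simp add: algebra_simps)
    also have "- (2 / N) + norm q / N\<^sup>2 + (N - norm q) / N\<^sup>2 = - (1 / N)"
      using N0 by (simp add: field_simps power2_eq_square)
    finally have "cstar_positive (p + (- (1 / N)) *\<^sub>R ?a)"
      using cstar_positive_add[OF cstar_positive_add[OF 1 2] 3] by (simp only:)
    then have "cstar_positive (p - (1 / N) *\<^sub>R ?a)" by simp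
    moreover have "cstar_positive ((1 / N) *\<^sub>R ?a)"
      using N0 by (intro cstar_positive_scaleR cstar_positive_mult_star) auto
    ultimately have "norm ((1 / N) *\<^sub>R ?a) \<le> norm p"
      by (rule cstar_positive_norm_mono[rotated])
    then show ?thesis using N0 by (simp add: norm_mult_star field_simps)
  qed
  show ?thesis
  proof (rule field_le_epsilon)
    fix e :: real assume e: "e > 0"
    have P: "norm p + 1 > 0" by (smt (verit) norm_ge_zero)
    have "(norm a)\<^sup>2 \<le> norm p * (norm q + e / (norm p + 1))"
      using e P by (intro *) simp
    also have "\<dots> \<le> norm p * norm q + e"
      using e P by (simp add: field_simps)
    finally show "(norm a)\<^sup>2 \<le> norm p * norm q + e" .
  qed
qed

lemma cauchy_schwarz_sum:
  fixes a b :: "'i \<Rightarrow> 'a::unital_cstar_algebra"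
  shows "(norm (\<Sum>i\<in>F. a i * star (b i)))\<^sup>2
    \<le> norm (\<Sum>i\<in>F. a i * star (a i)) * norm (\<Sum>i\<in>F. b i * star (b i))"
proof (rule cstar_cauchy_schwarz)
  fix c
  have "(\<Sum>i\<in>F. a i * star (a i)) - c * star (\<Sum>i\<in>F. a i * star (b i))
      - (\<Sum>i\<in>F. a i * star (b i)) * star c + c * (\<Sum>i\<in>F. b i * star (b i)) * star c
    = (\<Sum>i\<in>F. (a i - c * b i) * star (a i - c * b i))"
    by (simp add: star_sum star_mult star_diff star_star sum_distrib_left sum_distrib_right
        algebra_simps sum.distrib sum_subtractf)
  then show "cstar_positive ((\<Sum>i\<in>F. a i * star (a i)) - c * star (\<Sum>i\<in>F. a i * star (b i))
      - (\<Sum>i\<in>F. a i * star (b i)) * star c + c * (\<Sum>i\<in>F. b i * star (b i)) * star c)"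
    by (simp add: cstar_positive_sum cstar_positive_mult_star)
qed (simp add: star_sum star_mult star_star)

section \<open>Operators on Banach spaces\<close>

text \<open>By Baire, some sublevel set of x \<mapsto> norm (T x) is dense in a ball. Every x is
  thus approximated up to half its norm by a vector with controlled image; repeating this on the
  error writes x as a series, and closedness permits applying \<open>T\<close> termwise.\<close>

theorem closed_graph_theorem:
  fixes T :: "'e::banach \<Rightarrow> 'f::banach"
  assumes lin: "linear T"
    and closed: "\<And>X x y. X \<longlonglongrightarrow> x \<Longrightarrow> (\<lambda>n. T (X n)) \<longlonglongrightarrow> y \<Longrightarrow> T x = y"
  shows "bounded_linear T"
proof -
  interpret T: linear T by (rule lin)
  define A where "A n = closure {x. norm (T x) \<le> real n}" for n
  have "\<exists>n. interior (A n) \<noteq> {}"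
  proof (rule ccontr)
    assume "\<not> ?thesis"
    then have "euclidean interior_of \<Union> (range A) = {}"
      by (intro Baire_category_alt) (auto simp: A_def completely_metrizable_space_euclidean)
    moreover have "\<Union> (range A) = UNIV"
    proof (intro set_eqI iffI UNIV_I)
      fix x
      have "x \<in> A (nat \<lceil>norm (T x)\<rceil>)"
        unfolding A_def by (rule subsetD[OF closure_subset]) (simp add: real_nat_ceiling_ge)
      then show "x \<in> \<Union> (range A)" by blast
    qed
    ultimately show False by simp
  qed
  then obtain n x0 r where r: "r > 0" "ball x0 r \<subseteq> A n"
    by (metis all_not_in_conv mem_interior)
  \<comment> \<open>Differences of points near x0 + x and near x0 move the ball to the origin and
    double the bound \<open>n\<close>.\<close>
  have approx: "\<exists>u. norm (x - u) < e \<and> norm (T u) \<le> 2 * real n" if x: "norm x < r" and e: "e > 0" for x e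
  proof -
    have "x0 \<in> A n" "x0 + x \<in> A n" using r x by (auto simp: subset_iff dist_norm)
    then obtain v w where v: "norm (T v) \<le> real n" "dist v (x0 + x) < e / 2"
      and w: "norm (T w) \<le> real n" "dist w x0 < e / 2"
      unfolding A_def closure_approachable using e by (metis half_gt_zero mem_Collect_eq)
    have "norm (x - (v - w)) < e"
      using norm_triangle_ineq[of "w - x0" "x0 + x - v"] v(2) w(2)
      by (simp add: dist_norm norm_minus_commute[of v] algebra_simps)
    moreover have "norm (T (v - w)) \<le> 2 * real n"
      using norm_triangle_ineq4[of "T v" "T w"] v(1) w(1) by (simp add: T.diff)
    ultimately show ?thesis by blast
  qed
  \<comment> \<open>Scaling x to norm r/2 and approximating within r/4 gives relative error 1/2;
    scaling the bound 2n back multiplies it by 2 norm x / r.\<close>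
  define K where "K = 4 * real n / r"
  have "\<exists>u. norm (x - u) \<le> norm x / 2 \<and> norm (T u) \<le> K * norm x" for x
  proof (cases "x = 0")
    case True
    then show ?thesis by (intro exI[of _ 0]) (simp add: T.zero)
  next
    case False
    define s where "s = r / (2 * norm x)"
    have s: "s > 0" "norm (s *\<^sub>R x) < r" using False r by (simp_all add: s_def)
    obtain u where u: "norm (s *\<^sub>R x - u) < r / 4" "norm (T u) \<le> 2 * real n"
      using approx[OF s(2), of "r / 4"] r by auto
    have "x - (1 / s) *\<^sub>R u = (1 / s) *\<^sub>R (s *\<^sub>R x - u)"
      using s by (simp add: scaleR_diff_right)
    then have "norm (x - (1 / s) *\<^sub>R u) = (1 / s) * norm (s *\<^sub>R x - u)"
      using s by simp
    also have "\<dots> \<le> (1 / s) * (r / 4)" using u s by (intro mult_left_mono) auto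
    also have "\<dots> = norm x / 2" using r False by (simp add: s_def)
    finally have 1: "norm (x - (1 / s) *\<^sub>R u) \<le> norm x / 2" .
    have "norm (T ((1 / s) *\<^sub>R u)) = (1 / s) * norm (T u)" using s by (simp add: T.scale)
    also have "\<dots> \<le> (1 / s) * (2 * real n)" using u s by (intro mult_left_mono) auto
    also have "\<dots> = K * norm x" using r False by (simp add: s_def K_def)
    finally show ?thesis using 1 by blast
  qed
  then obtain g where g: "\<And>x. norm (x - g x) \<le> norm x / 2" "\<And>x. norm (T (g x)) \<le> K * norm x"
    by metis
  have K: "K \<ge> 0" using r by (simp add: K_def)
  have "norm (T x) \<le> norm x * (2 * K)" for x
  proof -
    define \<rho> where "\<rho> = rec_nat x (\<lambda>_ y. y - g y)"
    have \<rho>: "\<rho> 0 = x" "\<And>k. \<rho> (Suc k) = \<rho> k - g (\<rho> k)" by (simp_all add: \<rho>_def)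
    have n\<rho>: "norm (\<rho> k) \<le> norm x * (1/2) ^ k" for k
    proof (induction k)
      case (Suc k)
      have "norm (\<rho> (Suc k)) \<le> norm (\<rho> k) / 2" using g(1) by (simp add: \<rho>)
      then show ?case using Suc by simp
    qed (simp add: \<rho>)
    have sum_g: "(\<Sum>i<k. g (\<rho> i)) = x - \<rho> k" for k
      by (induction k) (simp_all add: \<rho>)
    have half: "(\<lambda>k. norm x * (1/2::real) ^ k) \<longlonglongrightarrow> norm x * 0"
      by (intro tendsto_intros LIMSEQ_power_zero) simp
    have "\<rho> \<longlonglongrightarrow> 0"
      by (rule Lim_null_comparison[OF _ half[unfolded mult_zero_right]]) (simp add: n\<rho>)
    then have lim: "(\<lambda>k. \<Sum>i<k. g (\<rho> i)) \<longlonglongrightarrow> x"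
      unfolding sum_g using tendsto_diff[OF tendsto_const[of x]] by fastforce
    have nT: "norm (T (g (\<rho> i))) \<le> K * (norm x * (1/2) ^ i)" for i
      using g(2)[of "\<rho> i"] mult_left_mono[OF n\<rho>[of i] K] by linarith
    have geo: "(\<lambda>i. K * (norm x * (1/2::real) ^ i)) sums (K * (norm x * 2))"
      using geometric_sums[of "1/2::real"] by (intro sums_mult) simp
    have summ: "summable (\<lambda>i. norm (T (g (\<rho> i))))"
      by (rule summable_comparison_test[OF _ sums_summable[OF geo]]) (use nT in auto)
    have "(\<lambda>k. T (\<Sum>i<k. g (\<rho> i))) \<longlonglongrightarrow> (\<Sum>i. T (g (\<rho> i)))"
      unfolding T.sum by (rule summable_LIMSEQ[OF summable_norm_cancel[OF summ]])
    then have "T x = (\<Sum>i. T (g (\<rho> i)))" by (rule closed[OF lim])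
    then have "norm (T x) \<le> (\<Sum>i. norm (T (g (\<rho> i))))" using summable_norm[OF summ] by simp
    also have "\<dots> \<le> K * (norm x * 2)"
      using suminf_le[OF nT summ sums_summable[OF geo]] sums_unique[OF geo] by simp
    finally show ?thesis by (simp add: mult.commute mult.left_commute)
  qed
  then show ?thesis
    by (intro bounded_linear_intro) (auto simp: T.add T.scale)
qed

text \<open>Solutions of M x = y are the fixed points of x \<mapsto> x - k M x + k y, a contraction.
  Boundedness of the inverse is supplied separately.\<close>

lemma bij_if_close_to_identity:
  fixes M :: "'e::banach \<Rightarrow> 'e"
  assumes "linear M" "k \<noteq> 0" "q < 1" and q: "\<And>x. norm (x - k *\<^sub>R M x) \<le> q * norm x"
  shows "bij M"
proof -
  interpret M: linear M by fact
  define c where "c = max 0 q"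
  have c: "0 \<le> c" "c < 1" "\<And>x. norm (x - k *\<^sub>R M x) \<le> c * norm x"
    using \<open>q < 1\<close> order_trans[OF q mult_right_mono[of q c]] by (auto simp: c_def)
  have "\<exists>!x. M x = y" for y
  proof -
    have "\<exists>!x. (x - k *\<^sub>R M x) + k *\<^sub>R y = x"
    proof (rule banach_fix_type[OF c(1,2)], intro allI)
      fix x z
      have "(x - k *\<^sub>R M x + k *\<^sub>R y) - (z - k *\<^sub>R M z + k *\<^sub>R y) = (x - z) - k *\<^sub>R M (x - z)"
        by (simp add: M.diff algebra_simps)
      then show "dist (x - k *\<^sub>R M x + k *\<^sub>R y) (z - k *\<^sub>R M z + k *\<^sub>R y) \<le> c * dist x z"
        unfolding dist_norm using c(3)[of "x - z"] by (simp only:)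
    qed
    moreover have "(x - k *\<^sub>R M x) + k *\<^sub>R y = x \<longleftrightarrow> M x = y" for x
      using \<open>k \<noteq> 0\<close> by (auto simp: algebra_simps)
    ultimately show ?thesis by simp
  qed
  then show ?thesis by (simp add: bij_iff)
qed

text \<open>The method of continuity, along the half-line of operators Q + t with t \<ge> 0.\<close>

lemma surj_if_shifts_bounded_below:
  fixes Q :: "'e::banach \<Rightarrow> 'e"
  assumes Q: "bounded_linear Q" and d: "d > 0"
    and low: "\<And>t x. t \<ge> 0 \<Longrightarrow> d * norm x \<le> norm (Q x + t *\<^sub>R x)"
  shows "surj Q"
proof -
  interpret Q: bounded_linear Q by (rule Q)
  define S where "S t x = Q x + t *\<^sub>R x" for t x
  have S_diff: "S t (x - y) = S t x - S t y" for t x y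
    by (simp add: S_def Q.diff algebra_simps)
  \<comment> \<open>S u x = y means S t x = y + (t - u) x. The lower bound gives the inverse of
    \<open>S t\<close> Lipschitz constant 1/d, so a shift of at most d/2 yields a contraction by
    1/2.\<close>
  have step: "surj (S u)" if t: "t \<ge> 0" "surj (S t)" "\<bar>t - u\<bar> \<le> d / 2" for t u
  proof (rule surjI[of _ "\<lambda>y. SOME x. S u x = y"])
    fix y
    define R where "R = inv (S t)"
    have R: "S t (R z) = z" for z unfolding R_def using t(2) by (rule surj_f_inv_f)
    have nR: "d * norm (R z - R w) \<le> norm (z - w)" for z w
      using low[OF t(1), of "R z - R w"] S_diff[of t "R z" "R w"] by (simp add: R flip: S_def)
    have "\<exists>!x. R (y + (t - u) *\<^sub>R x) = x"
    proof (rule banach_fix_type[of "1/2"], goal_cases)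
      case 3
      show ?case
      proof (intro allI)
        fix x z
        have "d * norm (R (y + (t - u) *\<^sub>R x) - R (y + (t - u) *\<^sub>R z)) \<le> norm ((t - u) *\<^sub>R (x - z))"
          using nR[of "y + (t - u) *\<^sub>R x" "y + (t - u) *\<^sub>R z"] by (simp add: algebra_simps)
        also have "\<dots> \<le> d / 2 * norm (x - z)" unfolding norm_scaleR using t(3) by (intro mult_right_mono) auto
        finally show "dist (R (y + (t - u) *\<^sub>R x)) (R (y + (t - u) *\<^sub>R z)) \<le> 1/2 * dist x z"
          using d by (simp add: dist_norm)
      qed
    qed auto
    then obtain x where "R (y + (t - u) *\<^sub>R x) = x" by blast
    then have "S t x = y + (t - u) *\<^sub>R x" using R by metis
    then have "S u x = y" by (simp add: S_def algebra_simps)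
    then show "S u (SOME x. S u x = y) = y" by (rule someI)
  qed
  obtain B where B: "B > 0" "\<And>x. norm (Q x) \<le> norm x * B" using Q.pos_bounded by blast
  \<comment> \<open>Large enough that S T / T differs from the identity by at most 1/2 in
    norm.\<close>
  define T where "T = 2 * B"
  have start: "surj (S T)"
  proof (rule bij_is_surj[OF bij_if_close_to_identity[where k = "1 / T" and q = "1/2"]])
    show "linear (S T)"
      by (intro linearI) (simp_all add: S_def Q.add Q.scale algebra_simps)
    show "norm (x - (1 / T) *\<^sub>R S T x) \<le> 1/2 * norm x" for x
    proof -
      have "x - (1 / T) *\<^sub>R S T x = - ((1 / T) *\<^sub>R Q x)"
        using B by (simp add: S_def T_def scaleR_add_right)
      then have "norm (x - (1 / T) *\<^sub>R S T x) = norm (Q x) / T"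
        using B(1) by (simp only:) (simp add: T_def)
      also have "\<dots> \<le> norm x * B / T" using B by (intro divide_right_mono) (auto simp: T_def)
      finally show ?thesis using B(1) by (simp add: T_def)
    qed
  qed (use B in \<open>auto simp: T_def\<close>)
  have "surj (S (max 0 (T - real n * (d / 2))))" for n
  proof (induction n)
    case 0
    then show ?case using start B by (simp add: T_def max_def)
  next
    case (Suc n)
    show ?case
      by (rule step[OF _ Suc]) (use d in \<open>auto simp: max_def algebra_simps\<close>)
  qed
  moreover obtain n where "real n * (d / 2) > T" using d reals_Archimedean3[of "d/2"] by auto
  ultimately have "surj (S 0)" by (metis diff_less_0_iff_less less_imp_le max.absorb1)
  then show ?thesis by (simp add: S_def[abs_def])
qed

lemma bij_inv_cancel: "bij f \<Longrightarrow> f (inv f y) = y" "bij f \<Longrightarrow> inv f (f x) = x"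
  by (simp_all add: bij_is_surj surj_f_inv_f bij_is_inj)

lemma linear_inv:
  assumes "linear f" "bij f"
  shows "linear (inv f)"
proof -
  interpret linear f by fact
  show ?thesis
    using assms(2)
    by (intro linearI; intro injD[OF bij_is_inj[OF assms(2)]])
       (simp_all add: add scale bij_inv_cancel)
qed

lemma bounded_linear_inv:
  fixes f :: "'e::banach \<Rightarrow> 'f::banach"
  assumes "bounded_linear f" "bij f"
  shows "bounded_linear (inv f)"
proof (rule closed_graph_theorem)
  show "linear (inv f)"
    using assms by (simp add: bounded_linear.linear linear_inv)
  fix X x y assume X: "X \<longlonglongrightarrow> x" "(\<lambda>n. inv f (X n)) \<longlonglongrightarrow> y"
  have "(\<lambda>n. f (inv f (X n))) \<longlonglongrightarrow> f y" by (rule bounded_linear.tendsto[OF assms(1) X(2)])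
  then have "X \<longlonglongrightarrow> f y" using assms(2) by (simp add: bij_inv_cancel)
  then have "x = f y" using X(1) LIMSEQ_unique by blast
  then show "inv f x = y" using assms(2) by (simp add: bij_inv_cancel)
qed

lemma invertible_opI:
  fixes f :: "'e::{complex_vector, banach} \<Rightarrow> 'e"
  assumes f: "bounded_clinear f" and b: "bij f"
  shows "invertible_op f"
proof -
  have "f (c *\<^sub>C x) = c *\<^sub>C f x" for c x using f by (simp add: bounded_clinear_def)
  then have "inv f (c *\<^sub>C x) = c *\<^sub>C inv f x" for c x
    using b by (metis bij_inv_cancel)
  then show ?thesis
    using f b bounded_linear_inv by (auto simp: invertible_op_def bounded_clinear_def)
qed

lemma bounded_clinear_compose:
  "bounded_clinear f \<Longrightarrow> bounded_clinear g \<Longrightarrow> bounded_clinear (f \<circ> g)"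
  unfolding bounded_clinear_def o_def using bounded_linear_compose[of f g] by auto

lemma invertible_op_compose:
  assumes "invertible_op f" "invertible_op g"
  shows "invertible_op (f \<circ> g)" "inv (f \<circ> g) = inv g \<circ> inv f"
proof -
  have b: "bij f" "bij g" using assms by (auto simp: invertible_op_def)
  show i: "inv (f \<circ> g) = inv g \<circ> inv f" using b by (rule o_inv_distrib)
  show "invertible_op (f \<circ> g)"
    using assms bounded_clinear_compose bij_comp[OF b(2,1)] unfolding invertible_op_def i by blast
qed

section \<open>Hilbert modules and adjointable operators\<close>

context hilbert_module
begin

lemma ip_zero_left [simp]: "ip 0 y = 0"
  by (metis add_cancel_right_right ip_add_left)

lemma ip_minus_left: "ip (- x) y = - ip x y"
  by (metis add.right_inverse add_eq_0_iff ip_add_left ip_zero_left)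

lemma ip_diff_left: "ip (x - y) z = ip x z - ip y z"
  using ip_add_left[of x "- y" z] by (simp add: ip_minus_left)

lemma ip_diff_right: "ip x (y - z) = ip x y - ip x z"
  by (metis ip_diff_left ip_star star_diff)

lemma ip_act_right: "ip x (act a y) = ip x y * star a"
  by (metis ip_act_left ip_star star_mult)

lemma ip_scaleC_left: "ip (c *\<^sub>C x) y = c *\<^sub>C ip x y"
  using ip_act_left[of "c *\<^sub>C 1" x y]
  by (simp add: act_scaleC_left act_one scaleC_mult_left)

lemma ip_scaleR_left: "ip (r *\<^sub>R x) y = r *\<^sub>R ip x y"
  by (simp add: scaleR_scaleC ip_scaleC_left)

lemma ip_scaleR_right: "ip x (r *\<^sub>R y) = r *\<^sub>R ip x y"
  by (metis ip_scaleR_left ip_star star_scaleR)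

lemma ip_sum_left: "ip (sum f F) y = (\<Sum>i\<in>F. ip (f i) y)"
  by (induction F rule: infinite_finite_induct) (simp_all add: ip_add_left)

lemma norm_ip_self: "norm (ip x x) = (norm x)\<^sup>2"
  by (simp add: norm_ip)

text \<open>The class constraints give homogeneity of the norm for real scalars only; the complex
  case comes from the inner product.\<close>

lemma norm_scaleC_module: "norm (c *\<^sub>C x) = cmod c * norm (x::'e)"
proof -
  have "ip (c *\<^sub>C x) (c *\<^sub>C x) = c *\<^sub>C cnj c *\<^sub>C ip x x"
    by (metis ip_scaleC_left ip_star star_scaleC)
  then have "(norm (c *\<^sub>C x))\<^sup>2 = (cmod c * norm x)\<^sup>2"
    by (simp flip: norm_ip_self) (simp add: norm_scaleC norm_ip_self power_mult_distrib power2_eq_square)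
  then show ?thesis by (rule power2_eq_imp_eq) auto
qed

lemma norm_ip_le: "norm (ip x y) \<le> norm x * norm y"
proof -
  have "(norm (ip x y))\<^sup>2 \<le> norm (ip x x) * norm (ip y y)"
  proof (rule cstar_cauchy_schwarz)
    fix b
    have "ip (x - act b y) (x - act b y)
        = ip x x - b * star (ip x y) - ip x y * star b + b * ip y y * star b"
      by (simp add: ip_diff_left ip_diff_right ip_act_left ip_act_right ip_star algebra_simps)
    then show "cstar_positive (ip x x - b * star (ip x y) - ip x y * star b + b * ip y y * star b)"
      by (metis ip_positive)
  qed (simp add: ip_star)
  then have "(norm (ip x y))\<^sup>2 \<le> (norm x * norm y)\<^sup>2"
    by (simp add: norm_ip_self power_mult_distrib)
  then show ?thesis by (rule power2_le_imp_le) simp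
qed

lemma bounded_linear_ip_left: "bounded_linear (\<lambda>x. ip x y)"
  by (rule bounded_linear_intro[of _ "norm y"]) (simp_all add: ip_add_left ip_scaleR_left norm_ip_le)

lemma ip_eqI:
  assumes "\<And>z. ip x z = ip y z"
  shows "x = y"
  using ip_definite[of "x - y"] assms by (simp add: ip_diff_left)

lemma is_adjoint_sym: "is_adjoint ip T S \<Longrightarrow> is_adjoint ip S T"
  unfolding is_adjoint_def by (metis ip_star)

lemma is_adjoint_unique:
  assumes "is_adjoint ip T S" "is_adjoint ip T S'"
  shows "S = S'"
proof
  fix y
  have "ip (S y) x = ip (S' y) x" for x
    using assms unfolding is_adjoint_def by (metis ip_star)
  then show "S y = S' y" by (rule ip_eqI)
qed

lemma module_adjoint_eq: "is_adjoint ip T S \<Longrightarrow> module_adjoint ip T = S"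
  unfolding module_adjoint_def using is_adjoint_unique by blast

lemma is_adjoint_act:
  assumes "is_adjoint ip T S"
  shows "T (act a x) = act a (T x)"
  using assms by (intro ip_eqI) (simp add: is_adjoint_def ip_act_left)

text \<open>The Hellinger-Toeplitz argument: inner products separate points, and moving
  \<open>T\<close> to the other side shows that its graph is closed.\<close>

lemma is_adjoint_bounded_clinear:
  assumes T: "is_adjoint ip T S"
  shows "bounded_clinear T"
proof -
  have adj: "ip (T x) y = ip x (S y)" for x y using T by (simp add: is_adjoint_def)
  have "bounded_linear T"
  proof (rule closed_graph_theorem)
    show "linear T"
      by (intro linearI; rule ip_eqI) (simp_all add: adj ip_add_left ip_scaleR_left)
    fix X x y assume X: "X \<longlonglongrightarrow> x" "(\<lambda>n. T (X n)) \<longlonglongrightarrow> y"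
    show "T x = y"
    proof (rule ip_eqI)
      fix z
      have "(\<lambda>n. ip (T (X n)) z) \<longlonglongrightarrow> ip y z"
        by (rule bounded_linear.tendsto[OF bounded_linear_ip_left X(2)])
      moreover have "(\<lambda>n. ip (X n) (S z)) \<longlonglongrightarrow> ip x (S z)"
        by (rule bounded_linear.tendsto[OF bounded_linear_ip_left X(1)])
      ultimately show "ip (T x) z = ip y z" unfolding adj by (rule LIMSEQ_unique[rotated])
    qed
  qed
  moreover have "T (c *\<^sub>C x) = c *\<^sub>C T x" for c x
    by (rule ip_eqI) (simp add: adj ip_scaleC_left)
  ultimately show ?thesis by (simp add: bounded_clinear_def)
qed

text \<open>
  With R = T* T / M of norm at most 1, positivity of (R^(2^k) - 1)^2 gives
  <R^(2^k) x, x> \<le> (<x, x> + <R^(2^(k+1)) x, x>) / 2; iterate and let k tend to infinity.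
\<close>

lemma adjointable_ip_le:
  assumes T: "is_adjoint ip T S"
  obtains K where "K > 0" "\<And>x. cstar_positive (K *\<^sub>R ip x x - ip (T x) (T x))"
proof -
  have bl: "bounded_linear T" "bounded_linear S"
    using is_adjoint_bounded_clinear is_adjoint_sym T by (auto simp: bounded_clinear_def)
  have adj: "ip (T x) y = ip x (S y)" "ip (S y) x = ip y (T x)" for x y
    using T is_adjoint_sym[OF T] by (simp_all add: is_adjoint_def)
  obtain M where M: "M > 0" "\<And>x. norm (S (T x)) \<le> norm x * M"
    using bounded_linear.pos_bounded[OF bounded_linear_compose[OF bl(2,1)]] by auto
  define R where "R x = (1 / M) *\<^sub>R S (T x)" for x
  have symR: "ip ((R ^^ n) x) y = ip x ((R ^^ n) y)" for n x y
  proof (induction n arbitrary: x y)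
    case (Suc n)
    have "ip (R u) v = ip u (R v)" for u v
      by (simp add: R_def ip_scaleR_left ip_scaleR_right adj)
    then have "ip ((R ^^ Suc n) x) y = ip ((R ^^ n) x) (R y)" by simp
    also have "\<dots> = ip x ((R ^^ n) (R y))" by (rule Suc)
    finally show ?case by (simp add: funpow_swap1)
  qed simp
  have nR: "norm ((R ^^ n) x) \<le> norm x" for n x
  proof (induction n)
    case (Suc n)
    have "norm (R y) \<le> norm y" for y using M by (simp add: R_def field_simps)
    then show ?case using Suc by (metis comp_apply funpow.simps(2) order_trans)
  qed simp
  have "cstar_positive (M *\<^sub>R ip x x - ip (T x) (T x))" for x
  proof -
    define p where "p k = ip ((R ^^ (2 ^ k)) x) x" for k :: nat
    \<comment> \<open>Starts at \<open>e 0 = 0\<close>; each increment is (1/2)^(k+1) times the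
      positive <V x - x, V x - x> with V = R^(2^k). As the norms of \<open>p k\<close> stay bounded,
      the limit is <x,x> - p 0.\<close>
    define e where "e k = (1 - (1/2) ^ k) *\<^sub>R ip x x + (1/2) ^ k *\<^sub>R p k - p 0" for k
    have "cstar_positive (e k)" for k
    proof (induction k)
      case (Suc k)
      let ?V = "R ^^ (2 ^ k)"
      have "ip (?V x - x) (?V x - x) = ip x x + p (Suc k) - 2 *\<^sub>R p k"
      proof -
        have "p (Suc k) = ip (?V x) (?V x)"
          using symR[of "2 ^ k" "?V x" x] by (simp add: p_def funpow_add mult_2)
        moreover have "ip x (?V x) = p k" by (simp add: p_def symR)
        ultimately show ?thesis
          by (simp add: ip_diff_left ip_diff_right scaleR_2 p_def)
      qed
      then have "cstar_positive (ip x x + p (Suc k) - 2 *\<^sub>R p k)" by (metis ip_positive)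
      then have "cstar_positive (e k + (1/2) ^ Suc k *\<^sub>R (ip x x + p (Suc k) - 2 *\<^sub>R p k))"
        by (intro cstar_positive_add Suc cstar_positive_scaleR) auto
      also have "e k + (1/2) ^ Suc k *\<^sub>R (ip x x + p (Suc k) - 2 *\<^sub>R p k)
          = (1 - (1/2) ^ k + (1/2) ^ Suc k) *\<^sub>R ip x x + (1/2) ^ Suc k *\<^sub>R p (Suc k)
            + ((1/2) ^ k - 2 * (1/2) ^ Suc k) *\<^sub>R p k - p 0"
        unfolding e_def by (simp only: algebra_simps scaleR_scaleR)
      also have "\<dots> = e (Suc k)" by (simp add: e_def)
      finally show ?case .
    qed (simp add: e_def)
    moreover have "e \<longlonglongrightarrow> ip x x - p 0"
    proof -
      have half: "(\<lambda>k. (1/2::real) ^ k) \<longlonglongrightarrow> 0" by (intro LIMSEQ_power_zero) simp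
      have half': "(\<lambda>k. (1/2::real) ^ k * (norm x * norm x)) \<longlonglongrightarrow> 0"
        using tendsto_mult_right[OF half, of "norm x * norm x"] by simp
      have "(\<lambda>k. (1/2) ^ k *\<^sub>R p k) \<longlonglongrightarrow> 0"
      proof (rule Lim_null_comparison[OF _ half'], intro always_eventually allI)
        fix k
        have "norm (p k) \<le> norm x * norm x"
          unfolding p_def using norm_ip_le mult_right_mono[OF nR norm_ge_zero] order_trans by blast
        then show "norm ((1/2) ^ k *\<^sub>R p k) \<le> (1/2) ^ k * (norm x * norm x)"
          by (simp add: divide_right_mono)
      qed
      then have "e \<longlonglongrightarrow> (1 - 0) *\<^sub>R ip x x + 0 - p 0"
        unfolding e_def[abs_def] by (intro tendsto_intros half)
      then show ?thesis by simp
    qed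
    ultimately have "cstar_positive (ip x x - p 0)"
      using cstar_positive_LIMSEQ by blast
    then have "cstar_positive (M *\<^sub>R (ip x x - p 0))"
      using M by (intro cstar_positive_scaleR) auto
    moreover have "M *\<^sub>R p 0 = ip (T x) (T x)"
      using M by (simp add: p_def R_def ip_scaleR_left adj)
    ultimately show ?thesis by (simp add: scaleR_diff_right)
  qed
  then show thesis using that M by blast
qed

text \<open>Surjectivity of \<open>W\<close> makes \<open>S\<close> injective. For surjectivity of
  \<open>S\<close> it suffices that S W is onto: pairing (S W + t) x with x gives at least the
  square of norm (W x), hence a lower bound uniform in t from the bounded inverse of
  \<open>W\<close>.\<close>

lemma is_adjoint_bij:
  assumes W: "is_adjoint ip W S" and b: "bij W"
  shows "bij S" "is_adjoint ip (inv W) (inv S)"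
proof -
  have bl: "bounded_linear W" "bounded_linear S"
    using is_adjoint_bounded_clinear is_adjoint_sym W by (auto simp: bounded_clinear_def)
  have adj: "ip (W x) y = ip x (S y)" "ip (S y) x = ip y (W x)" for x y
    using W is_adjoint_sym[OF W] by (simp_all add: is_adjoint_def)
  obtain B where B: "B > 0" "\<And>x. norm (inv W x) \<le> norm x * B"
    using bounded_linear.pos_bounded[OF bounded_linear_inv[OF bl(1) b]] by auto
  have "inj S"
  proof (rule injI)
    fix x y assume "S x = S y"
    then have "ip z x = ip z y" for z
      using adj(1)[of "inv W z"] b by (metis bij_inv_cancel(1))
    then show "x = y" by (intro ip_eqI) (metis ip_star)
  qed
  moreover have "surj (S \<circ> W)"
  proof (rule surj_if_shifts_bounded_below[of _ "1 / B\<^sup>2"])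
    show "bounded_linear (S \<circ> W)" using bounded_linear_compose[OF bl(2,1)] by (simp add: o_def)
    show "1 / B\<^sup>2 > 0" using B by simp
    fix t :: real and x assume t: "t \<ge> 0"
    show "1 / B\<^sup>2 * norm x \<le> norm ((S \<circ> W) x + t *\<^sub>R x)"
    proof (cases "x = 0")
      case False
      have "norm x \<le> norm (W x) * B" using B(2)[of "W x"] b by (simp add: bij_inv_cancel)
      then have "norm x / B \<le> norm (W x)" using B(1) by (simp add: field_simps)
      then have "(norm x / B)\<^sup>2 \<le> (norm (W x))\<^sup>2" using B by (intro power_mono) auto
      also have "\<dots> = norm (ip (W x) (W x))" by (simp add: norm_ip_self)
      also have "\<dots> \<le> norm (ip (W x) (W x) + t *\<^sub>R ip x x)"
        using t by (intro cstar_positive_norm_mono) (simp_all add: ip_positive cstar_positive_scaleR)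
      also have "ip (W x) (W x) + t *\<^sub>R ip x x = ip ((S \<circ> W) x + t *\<^sub>R x) x"
        by (simp add: ip_add_left ip_scaleR_left adj)
      also have "norm \<dots> \<le> norm ((S \<circ> W) x + t *\<^sub>R x) * norm x" by (rule norm_ip_le)
      finally have "(1 / B\<^sup>2 * norm x) * norm x \<le> norm ((S \<circ> W) x + t *\<^sub>R x) * norm x"
        by (simp add: power2_eq_square)
      then show ?thesis by (rule mult_right_le_imp_le) (use False in simp)
    qed simp
  qed
  then have "\<forall>y. \<exists>x. y = S (W x)" by (simp add: surj_def)
  then have "surj S" unfolding surj_def by blast
  ultimately show bS: "bij S" by (simp add: bij_def)
  show "is_adjoint ip (inv W) (inv S)"
    unfolding is_adjoint_def
  proof (intro allI)
    fix x y
    show "ip (inv W x) y = ip x (inv S y)"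
      using adj(1)[of "inv W x" "inv S y"] b bS by (simp add: bij_inv_cancel)
  qed
qed

end

section \<open>The standard module\<close>

text \<open>Convergence here need not be absolute; the comparison works because the order dominates
  the norm of every finite section, which is the Cauchy criterion.\<close>

lemma summable_cstar_mono:
  fixes f g :: "nat \<Rightarrow> 'a::unital_cstar_algebra"
  assumes "summable g" "\<And>n. cstar_positive (f n)" "\<And>n. cstar_positive (g n - f n)"
  shows "summable f" "norm (suminf f) \<le> norm (suminf g)"
proof -
  have le: "norm (sum f F) \<le> norm (sum g F)" for F
    by (rule cstar_positive_norm_mono)
       (simp_all add: assms cstar_positive_sum flip: sum_subtractf)
  show f: "summable f"
    using assms(1) le unfolding summable_Cauchy by (meson le_less_trans)
  have "cstar_positive (suminf g - suminf f)"
    unfolding suminf_diff[OF assms(1) f]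
    by (intro cstar_positive_suminf summable_diff assms f)
  then show "norm (suminf f) \<le> norm (suminf g)"
    by (intro cstar_positive_norm_mono cstar_positive_suminf assms f)
qed

lemma norm_sum_le_suminf:
  fixes f :: "nat \<Rightarrow> 'a::unital_cstar_algebra"
  assumes "summable f" "\<And>n. cstar_positive (f n)" "finite F"
  shows "norm (sum f F) \<le> norm (suminf f)"
proof -
  let ?g = "\<lambda>n. if n \<in> F then f n else 0"
  have "norm (suminf ?g) \<le> norm (suminf f)"
    by (rule summable_cstar_mono(2)[OF assms(1)]) (use assms(2) in auto)
  moreover have "suminf ?g = sum ?g F" by (rule suminf_finite) (use assms(3) in auto)
  ultimately show ?thesis by simp
qed

lemma ell2_norm_power2: "(ell2_norm a)\<^sup>2 = norm (\<Sum>n. a n * star (a n))"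
  by (simp add: ell2_norm_def ell2_ip_def)

lemma ell2_norm_nonneg: "ell2_norm a \<ge> 0"
  by (simp add: ell2_norm_def)

lemma ell2_add:
  fixes a b :: "nat \<Rightarrow> 'a::unital_cstar_algebra"
  assumes "a \<in> ell2" "b \<in> ell2"
  shows "(\<lambda>n. a n + b n) \<in> ell2"
    "(ell2_norm (\<lambda>n. a n + b n))\<^sup>2 \<le> 2 * ((ell2_norm a)\<^sup>2 + (ell2_norm b)\<^sup>2)"
proof -
  let ?g = "\<lambda>n. 2 *\<^sub>R (a n * star (a n) + b n * star (b n))"
  let ?f = "\<lambda>n. (a n + b n) * star (a n + b n)"
  have s: "summable (\<lambda>n. a n * star (a n))" "summable (\<lambda>n. b n * star (b n))"
    using assms by (auto simp: ell2_def)
  have g: "summable ?g" by (intro summable_scaleR_right summable_add s)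
  have pos: "cstar_positive (?g n - ?f n)" for n
  proof -
    have "?g n - ?f n = (a n - b n) * star (a n - b n)"
      by (simp add: star_add star_diff scaleR_2 algebra_simps)
    then show ?thesis by (simp only: cstar_positive_mult_star)
  qed
  note m = summable_cstar_mono[OF g cstar_positive_mult_star pos]
  show "(\<lambda>n. a n + b n) \<in> ell2" using m(1) by (simp add: ell2_def)
  have "suminf ?g = 2 *\<^sub>R ((\<Sum>n. a n * star (a n)) + (\<Sum>n. b n * star (b n)))"
    unfolding suminf_add[OF s] by (rule suminf_scaleR_right[OF summable_add[OF s], symmetric])
  then have "norm (suminf ?g) \<le> 2 * ((ell2_norm a)\<^sup>2 + (ell2_norm b)\<^sup>2)"
    using norm_triangle_ineq[of "\<Sum>n. a n * star (a n)" "\<Sum>n. b n * star (b n)"]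
    by (simp add: ell2_norm_power2)
  then show "(ell2_norm (\<lambda>n. a n + b n))\<^sup>2 \<le> 2 * ((ell2_norm a)\<^sup>2 + (ell2_norm b)\<^sup>2)"
    using m(2) by (simp add: ell2_norm_power2)
qed

lemma ell2_scaleC:
  fixes a :: "nat \<Rightarrow> 'a::unital_cstar_algebra"
  assumes "a \<in> ell2"
  shows "(\<lambda>n. c *\<^sub>C a n) \<in> ell2" "ell2_norm (\<lambda>n. c *\<^sub>C a n) = cmod c * ell2_norm a"
proof -
  have s: "summable (\<lambda>n. a n * star (a n))" using assms by (simp add: ell2_def)
  have e: "(c *\<^sub>C a n) * star (c *\<^sub>C a n) = (cmod c)\<^sup>2 *\<^sub>R (a n * star (a n))" for n
    by (simp add: star_scaleC scaleC_mult_left scaleC_mult_right scaleC_scaleC complex_norm_square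
        scaleR_scaleC mult.commute del: of_real_power)
  show "(\<lambda>n. c *\<^sub>C a n) \<in> ell2"
    unfolding ell2_def mem_Collect_eq e by (rule summable_scaleR_right[OF s])
  have "(ell2_norm (\<lambda>n. c *\<^sub>C a n))\<^sup>2 = (cmod c * ell2_norm a)\<^sup>2"
    unfolding power_mult_distrib ell2_norm_power2 e suminf_scaleR_right[OF s, symmetric] by simp
  then show "ell2_norm (\<lambda>n. c *\<^sub>C a n) = cmod c * ell2_norm a"
    by (rule power2_eq_imp_eq) (simp_all add: ell2_norm_nonneg)
qed

text \<open>\<open>ell2_onorm\<close> is a real supremum and means something only for a bounded set;
  the crude constant \<open>K\<close> secures this and also settles vectors of norm 0, which cannot
  be normalized.\<close>

lemma ell2_onorm_bound:
  fixes R :: "(nat \<Rightarrow> 'a::unital_cstar_algebra) \<Rightarrow> nat \<Rightarrow> 'a"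
  assumes hom: "\<And>c a. a \<in> ell2 \<Longrightarrow> R (\<lambda>n. c *\<^sub>C a n) = (\<lambda>n. c *\<^sub>C R a n)"
    and ell2: "\<And>a. a \<in> ell2 \<Longrightarrow> R a \<in> ell2"
    and bnd: "\<And>a. a \<in> ell2 \<Longrightarrow> ell2_norm (R a) \<le> K * ell2_norm a"
  shows "ell2_onorm R \<ge> 0" "a \<in> ell2 \<Longrightarrow> ell2_norm (R a) \<le> ell2_onorm R * ell2_norm a"
proof -
  let ?S = "{a \<in> ell2. ell2_norm a \<le> 1}"
  have "ell2_norm (R a) \<le> max K 0" if "a \<in> ?S" for a
  proof -
    have "ell2_norm (R a) \<le> max K 0 * ell2_norm a"
      using bnd[of a] that ell2_norm_nonneg[of a] mult_right_mono[of K "max K 0" "ell2_norm a"]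
      by fastforce
    also have "\<dots> \<le> max K 0" using that by (intro mult_left_le) auto
    finally show ?thesis .
  qed
  then have bdd: "bdd_above ((\<lambda>a. ell2_norm (R a)) ` ?S)" by (intro bdd_aboveI2)
  have up: "ell2_norm (R a) \<le> ell2_onorm R" if "a \<in> ?S" for a
    unfolding ell2_onorm_def by (rule cSUP_upper[OF that bdd])
  have "(\<lambda>n. 0) \<in> ?S" by (simp add: ell2_def ell2_norm_def ell2_ip_def)
  from up[OF this] show "ell2_onorm R \<ge> 0" using ell2_norm_nonneg order_trans by blast
  show "ell2_norm (R a) \<le> ell2_onorm R * ell2_norm a" if a: "a \<in> ell2"
  proof (cases "ell2_norm a = 0")
    case True
    then show ?thesis using bnd[OF a] by simp
  next
    case False
    define c where "c = complex_of_real (1 / ell2_norm a)"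
    have c: "cmod c = 1 / ell2_norm a" using ell2_norm_nonneg[of a] by (simp add: c_def norm_divide)
    have "(\<lambda>n. c *\<^sub>C a n) \<in> ?S"
      using ell2_scaleC[OF a, of c] False by (simp add: c)
    from up[OF this] have "cmod c * ell2_norm (R a) \<le> ell2_onorm R"
      using hom[OF a] ell2_scaleC(2)[OF ell2[OF a], of c] by simp
    then show ?thesis using False ell2_norm_nonneg[of a] by (simp add: c field_simps)
  qed
qed

lemma ell2_onorm_minus_identity:
  fixes U :: "(nat \<Rightarrow> 'a::unital_cstar_algebra) \<Rightarrow> nat \<Rightarrow> 'a"
  assumes "ell2_bounded_op U"
  defines "R \<equiv> \<lambda>a n. U a n - a n"
  shows "ell2_onorm R \<ge> 0"
    "a \<in> ell2 \<Longrightarrow> R a \<in> ell2"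
    "a \<in> ell2 \<Longrightarrow> ell2_norm (R a) \<le> ell2_onorm R * ell2_norm a"
proof -
  have "\<exists>K. \<forall>a\<in>ell2. ell2_norm (U a) \<le> K * ell2_norm a"
    using assms(1) by (simp add: ell2_bounded_op_def)
  then obtain K where K: "\<And>a. a \<in> ell2 \<Longrightarrow> ell2_norm (U a) \<le> K * ell2_norm a"
    by blast
  have U: "U a \<in> ell2" if "a \<in> ell2" for a using assms(1) that by (simp add: ell2_bounded_op_def)
  have hom: "R (\<lambda>n. c *\<^sub>C a n) = (\<lambda>n. c *\<^sub>C R a n)" if "a \<in> ell2" for c a
    using assms(1) that by (simp add: R_def ell2_bounded_op_def scaleC_diff_right)
  have Req: "R a = (\<lambda>n. U a n + (- 1) *\<^sub>C a n)" for a
    by (simp add: R_def scaleC_minus_left scaleC_one)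
  have ell: "R a \<in> ell2" if "a \<in> ell2" for a
    unfolding Req by (intro ell2_add ell2_scaleC U that)
  have bnd: "ell2_norm (R a) \<le> sqrt (2 * (K\<^sup>2 + 1)) * ell2_norm a" if a: "a \<in> ell2" for a
  proof (rule power2_le_imp_le)
    have "(ell2_norm (R a))\<^sup>2 \<le> 2 * ((ell2_norm (U a))\<^sup>2 + (ell2_norm (\<lambda>n. (- 1) *\<^sub>C a n))\<^sup>2)"
      unfolding Req by (intro ell2_add ell2_scaleC U a)
    also have "ell2_norm (\<lambda>n. (- 1) *\<^sub>C a n) = ell2_norm a"
      using ell2_scaleC(2)[OF a, of "- 1"] by simp
    also have "(ell2_norm (U a))\<^sup>2 \<le> (K * ell2_norm a)\<^sup>2"
      by (intro power_mono K a ell2_norm_nonneg)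
    finally show "(ell2_norm (R a))\<^sup>2 \<le> (sqrt (2 * (K\<^sup>2 + 1)) * ell2_norm a)\<^sup>2"
      by (simp add: power_mult_distrib algebra_simps)
  qed (simp add: ell2_norm_nonneg)
  show "ell2_onorm R \<ge> 0" by (rule ell2_onorm_bound(1)[OF hom ell bnd])
  show "a \<in> ell2 \<Longrightarrow> ell2_norm (R a) \<le> ell2_onorm R * ell2_norm a"
    by (rule ell2_onorm_bound(2)[OF hom ell bnd])
  show "a \<in> ell2 \<Longrightarrow> R a \<in> ell2" by (rule ell)
qed

section \<open>Frames and multipliers\<close>

context hilbert_module
begin

text \<open>Cauchy-Schwarz for the form <B x, y> at y = B x bounds norm (B x)^4 by r norm x^2 times
  r norm (B x)^2. This converts operator inequalities into norm bounds on the module itself.\<close>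

lemma norm_le_if_selfadjoint_positive:
  assumes B: "is_adjoint ip B B" and r: "r \<ge> 0"
    and pos: "\<And>x. cstar_positive (ip (B x) x)"
    and le: "\<And>x. cstar_positive (r *\<^sub>R ip x x - ip (B x) x)"
  shows "norm (B x) \<le> r * norm x"
proof -
  have n: "norm (ip (B x) x) \<le> r * (norm x)\<^sup>2" for x
    using cstar_positive_norm_mono[OF pos le] r by (simp add: norm_ip_self)
  have B_diff: "B (x - y) = B x - B y" for x y
    using is_adjoint_bounded_clinear[OF B] by (simp add: bounded_clinear_def linear_simps)
  have "(norm (ip (B x) y))\<^sup>2 \<le> norm (ip (B x) x) * norm (ip (B y) y)" for x y
  proof (rule cstar_cauchy_schwarz)
    have sym: "ip (B u) v = star (ip (B v) u)" for u v
      using B by (simp add: is_adjoint_def ip_star)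
    fix b
    have "ip (B (x - act b y)) (x - act b y)
        = ip (B x) x - b * ip (B y) x - ip (B x) y * star b + b * ip (B y) y * star b"
      by (simp add: B_diff is_adjoint_act[OF B] ip_diff_left ip_diff_right ip_act_left ip_act_right
          algebra_simps)
    also have "ip (B y) x = star (ip (B x) y)" by (rule sym)
    finally show "cstar_positive (ip (B x) x - b * star (ip (B x) y) - ip (B x) y * star b
        + b * ip (B y) y * star b)"
      using pos by metis
    show "star (ip (B y) y) = ip (B y) y" by (simp add: cstar_positiveD(1)[OF pos])
  qed
  from this[of x "B x"] have "(norm (B x))\<^sup>2 * (norm (B x))\<^sup>2 \<le> (r * (norm x)\<^sup>2) * (r * (norm (B x))\<^sup>2)"
    using mult_mono[OF n[of x] n[of "B x"]] r by (simp add: norm_ip_self power2_eq_square)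
  then have "(norm (B x))\<^sup>2 * (norm (B x))\<^sup>2 \<le> (r * norm x)\<^sup>2 * (norm (B x))\<^sup>2"
    by (simp add: power2_eq_square mult_ac)
  then have "B x = 0 \<or> (norm (B x))\<^sup>2 \<le> (r * norm x)\<^sup>2"
    using mult_right_le_imp_le[of "(norm (B x))\<^sup>2" "(norm (B x))\<^sup>2"] by fastforce
  then show ?thesis
    using r power2_le_imp_le[of "norm (B x)" "r * norm x"] by auto
qed

section \<open>Analysis, synthesis and frame operator of a fixed frame\<close>

context
  fixes Y :: "nat \<Rightarrow> 'e" and C D :: real
  assumes frame: "frame_constants ip Y C D"
begin

lemma frame_constants_pos: "C > 0" "D > 0"
  using frame by (simp_all add: frame_constants_def)

lemma summable_frame: "summable (\<lambda>n. ip z (Y n) * ip (Y n) z)"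
  using frame by (simp add: frame_constants_def)

lemma frame_lower: "cstar_positive ((\<Sum>n. ip z (Y n) * ip (Y n) z) - C *\<^sub>R ip z z)"
  using frame by (simp add: frame_constants_def cstar_le_def)

lemma frame_upper: "cstar_positive (D *\<^sub>R ip z z - (\<Sum>n. ip z (Y n) * ip (Y n) z))"
  using frame by (simp add: frame_constants_def cstar_le_def)

lemma frame_term_positive: "cstar_positive (ip z (Y n) * ip (Y n) z)"
  using cstar_positive_mult_star[of "ip z (Y n)"] by (simp add: ip_star)

lemma norm_frame_sum_le: "norm (\<Sum>n. ip z (Y n) * ip (Y n) z) \<le> D * (norm z)\<^sup>2"
  using cstar_positive_norm_mono[OF cstar_positive_suminf[OF summable_frame frame_term_positive]
      frame_upper, of z] frame_constants_pos
  by (simp add: norm_ip_self)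

lemma analysis_op_ell2: "analysis_op ip Y z \<in> ell2"
  using summable_frame by (simp add: ell2_def analysis_op_def ip_star)

lemma ell2_norm_analysis_op: "ell2_norm (analysis_op ip Y z) \<le> sqrt D * norm z"
proof (rule power2_le_imp_le)
  show "(ell2_norm (analysis_op ip Y z))\<^sup>2 \<le> (sqrt D * norm z)\<^sup>2"
    using norm_frame_sum_le[of z] frame_constants_pos
    by (simp add: ell2_norm_power2 analysis_op_def ip_star power_mult_distrib)
qed (use frame_constants_pos in simp)

text \<open>Duality: <v,v> is the sum of a_n <v,y_n>*, so Cauchy-Schwarz and the upper frame bound
  give norm v^4 <= A D norm v^2. Finite sets are needed to establish convergence of the synthesis
  series.\<close>

lemma norm_sum_act_le:
  assumes "finite F"
  shows "(norm (\<Sum>n\<in>F. act (a n) (Y n)))\<^sup>2 \<le> D * norm (\<Sum>n\<in>F. a n * star (a n))"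
proof -
  define v where "v = (\<Sum>n\<in>F. act (a n) (Y n))"
  define A where "A = norm (\<Sum>n\<in>F. a n * star (a n))"
  have "ip v v = (\<Sum>n\<in>F. a n * star (ip v (Y n)))"
    by (subst v_def) (simp add: ip_sum_left ip_act_left ip_star)
  then have "(norm (ip v v))\<^sup>2 \<le> A * norm (\<Sum>n\<in>F. ip v (Y n) * star (ip v (Y n)))"
    unfolding A_def by (metis cauchy_schwarz_sum)
  also have "\<dots> \<le> A * (D * (norm v)\<^sup>2)"
    using norm_sum_le_suminf[OF summable_frame frame_term_positive assms, of v] norm_frame_sum_le[of v]
    by (intro mult_left_mono) (simp_all add: ip_star A_def)
  finally have "(norm v)\<^sup>2 * (norm v)\<^sup>2 \<le> (D * A) * (norm v)\<^sup>2"
    by (simp add: norm_ip_self power2_eq_square mult_ac)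
  then have "v = 0 \<or> (norm v)\<^sup>2 \<le> D * A"
    using mult_right_le_imp_le[of "(norm v)\<^sup>2" "(norm v)\<^sup>2" "D * A"] by fastforce
  moreover have "D * A \<ge> 0" using frame_constants_pos by (simp add: A_def)
  ultimately show ?thesis unfolding v_def[symmetric] A_def[symmetric] by auto
qed

lemma summable_synthesis:
  assumes "a \<in> ell2"
  shows "summable (\<lambda>n. act (a n) (Y n))"
  unfolding summable_Cauchy
proof (intro allI impI)
  fix e :: real assume e: "e > 0"
  have "summable (\<lambda>n. a n * star (a n))" using assms by (simp add: ell2_def)
  moreover have "e\<^sup>2 / D > 0" using e frame_constants_pos by simp
  ultimately obtain N where N: "\<And>m n. m \<ge> N \<Longrightarrow> norm (\<Sum>k=m..<n. a k * star (a k)) < e\<^sup>2 / D"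
    unfolding summable_Cauchy by metis
  show "\<exists>N. \<forall>m\<ge>N. \<forall>n. norm (\<Sum>k=m..<n. act (a k) (Y k)) < e"
  proof (intro exI allI impI)
    fix m n assume "m \<ge> N"
    have "(norm (\<Sum>k=m..<n. act (a k) (Y k)))\<^sup>2 \<le> D * norm (\<Sum>k=m..<n. a k * star (a k))"
      by (rule norm_sum_act_le) simp
    also have "\<dots> < e\<^sup>2" using N[OF \<open>m \<ge> N\<close>, of n] frame_constants_pos by (simp add: field_simps)
    finally show "norm (\<Sum>k=m..<n. act (a k) (Y k)) < e"
      by (rule power2_less_imp_less) (use e in simp)
  qed
qed

lemma norm_synthesis_op:
  assumes "a \<in> ell2"
  shows "norm (synthesis_op act Y a) \<le> sqrt D * ell2_norm a"
proof (rule power2_le_imp_le)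
  have "(\<lambda>N. (norm (\<Sum>n<N. act (a n) (Y n)))\<^sup>2) \<longlonglongrightarrow> (norm (synthesis_op act Y a))\<^sup>2"
    unfolding synthesis_op_def
    by (intro tendsto_intros summable_LIMSEQ summable_synthesis assms)
  moreover have "(\<lambda>N. D * norm (\<Sum>n<N. a n * star (a n))) \<longlonglongrightarrow> D * (ell2_norm a)\<^sup>2"
    unfolding ell2_norm_power2 using assms
    by (intro tendsto_intros summable_LIMSEQ) (simp add: ell2_def)
  ultimately have "(norm (synthesis_op act Y a))\<^sup>2 \<le> D * (ell2_norm a)\<^sup>2"
    by (rule LIMSEQ_le) (use norm_sum_act_le in blast)
  then show "(norm (synthesis_op act Y a))\<^sup>2 \<le> (sqrt D * ell2_norm a)\<^sup>2"
    using frame_constants_pos by (simp add: power_mult_distrib)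
qed (use frame_constants_pos in \<open>simp add: ell2_norm_nonneg\<close>)

lemma synthesis_op_add:
  assumes "a \<in> ell2" "b \<in> ell2"
  shows "synthesis_op act Y (\<lambda>n. a n + b n) = synthesis_op act Y a + synthesis_op act Y b"
  unfolding synthesis_op_def act_add_left
  by (rule suminf_add[OF summable_synthesis summable_synthesis, OF assms, symmetric])

lemma synthesis_op_scaleC:
  assumes "a \<in> ell2"
  shows "synthesis_op act Y (\<lambda>n. c *\<^sub>C a n) = c *\<^sub>C synthesis_op act Y a"
proof -
  have "bounded_linear (\<lambda>x::'e. c *\<^sub>C x)"
    by (rule bounded_linear_intro[of _ "cmod c"])
       (simp_all add: scaleC_add_right scaleR_scaleC scaleC_scaleC mult.commute norm_scaleC_module)
  from bounded_linear.suminf[OF this summable_synthesis[OF assms]]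
  show ?thesis by (simp add: synthesis_op_def act_scaleC_left)
qed

lemma synthesis_op_image:
  assumes W: "is_adjoint ip W W'" and a: "a \<in> ell2"
  shows "synthesis_op act (\<lambda>n. W (Y n)) a = W (synthesis_op act Y a)"
proof -
  have "bounded_linear W"
    using is_adjoint_bounded_clinear[OF W] by (simp add: bounded_clinear_def)
  from bounded_linear.suminf[OF this summable_synthesis[OF a]]
  show ?thesis by (simp add: synthesis_op_def is_adjoint_act[OF W])
qed

lemma ip_frame_operator:
  "ip (synthesis_op act Y (analysis_op ip Y x)) y = (\<Sum>n. ip x (Y n) * ip (Y n) y)"
  using bounded_linear.suminf[OF bounded_linear_ip_left summable_synthesis[OF analysis_op_ell2]]
  by (simp add: synthesis_op_def analysis_op_def ip_act_left)

lemma frame_operator_self_adjoint: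
  "is_adjoint ip (synthesis_op act Y \<circ> analysis_op ip Y) (synthesis_op act Y \<circ> analysis_op ip Y)"
  unfolding is_adjoint_def
proof (intro allI)
  fix x y
  have "summable (\<lambda>n. ip y (Y n) * ip (Y n) x)"
    using bounded_linear.summable[OF bounded_linear_ip_left summable_synthesis[OF analysis_op_ell2]]
    by (simp add: analysis_op_def ip_act_left)
  then have "star (\<Sum>n. ip y (Y n) * ip (Y n) x) = (\<Sum>n. ip x (Y n) * ip (Y n) y)"
    by (subst bounded_linear.suminf[OF bounded_linear_star]) (simp_all add: star_mult ip_star)
  then have "star (ip (synthesis_op act Y (analysis_op ip Y y)) x)
      = ip (synthesis_op act Y (analysis_op ip Y x)) y"
    by (simp add: ip_frame_operator)
  then show "ip ((synthesis_op act Y \<circ> analysis_op ip Y) x) y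
      = ip x ((synthesis_op act Y \<circ> analysis_op ip Y) y)"
    by (simp add: ip_star)
qed

text \<open>The frame inequalities say that 1 - S/D lies between 0 and 1 - C/D, S being the frame
  operator.\<close>

lemma frame_operator_near_identity:
  "norm (x - (1 / D) *\<^sub>R synthesis_op act Y (analysis_op ip Y x)) \<le> (1 - C / D) * norm x"
proof (cases "x = 0")
  case True
  let ?S = "synthesis_op act Y \<circ> analysis_op ip Y"
  have "?S 0 = 0"
    using is_adjoint_bounded_clinear[OF frame_operator_self_adjoint]
    by (simp only: bounded_clinear_def linear_simps)
  then show ?thesis using True by simp
next
  case False
  define B where "B x = x - (1 / D) *\<^sub>R synthesis_op act Y (analysis_op ip Y x)" for x
  have ipB: "ip (B x) y = ip x y - (1 / D) *\<^sub>R (\<Sum>n. ip x (Y n) * ip (Y n) y)" for x y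
    by (simp add: B_def ip_diff_left ip_scaleR_left ip_frame_operator)
  have D: "D > 0" using frame_constants_pos by simp
  \<comment> \<open>C <= D is read off from a nonzero vector, hence the case split.\<close>
  have "cstar_positive (D *\<^sub>R ip x x - C *\<^sub>R ip x x)"
    using cstar_positive_add[OF frame_upper[of x] frame_lower[of x]] by simp
  then have "norm (C *\<^sub>R ip x x) \<le> norm (D *\<^sub>R ip x x)"
    using frame_constants_pos
    by (intro cstar_positive_norm_mono) (simp_all add: cstar_positive_scaleR ip_positive)
  then have CD: "C \<le> D" using False frame_constants_pos by (simp add: norm_ip_self)
  have "norm (B x) \<le> (1 - C / D) * norm x"
  proof (rule norm_le_if_selfadjoint_positive)
    show "is_adjoint ip B B"
      using frame_operator_self_adjoint
      by (simp add: is_adjoint_def B_def ip_diff_left ip_diff_right ip_scaleR_left ip_scaleR_right)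
    show "1 - C / D \<ge> 0" using CD D by simp
    fix z
    have "cstar_positive ((1 / D) *\<^sub>R (D *\<^sub>R ip z z - (\<Sum>n. ip z (Y n) * ip (Y n) z)))"
      using D by (intro cstar_positive_scaleR frame_upper) simp
    then show "cstar_positive (ip (B z) z)"
      using D by (simp add: ipB scaleR_diff_right)
    have "cstar_positive ((1 / D) *\<^sub>R ((\<Sum>n. ip z (Y n) * ip (Y n) z) - C *\<^sub>R ip z z))"
      using D by (intro cstar_positive_scaleR frame_lower) simp
    then show "cstar_positive ((1 - C / D) *\<^sub>R ip z z - ip (B z) z)"
      by (simp add: ipB scaleR_diff_right scaleR_diff_left)
  qed
  then show ?thesis by (simp add: B_def)
qed

lemma gen_multiplier_invertible:
  assumes U: "ell2_bounded_op U" and small: "ell2_onorm (\<lambda>a n. U a n - a n) < C / D"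
  shows "invertible_op (gen_multiplier act ip U Y Y)"
proof (rule invertible_opI)
  let ?T = "analysis_op ip Y" and ?s = "synthesis_op act Y"
  define M where "M = gen_multiplier act ip U Y Y"
  define R where "R a n = U a n - a n" for a n
  define u where "u = ell2_onorm R"
  have u: "u < C / D" "u \<ge> 0" "\<And>a. a \<in> ell2 \<Longrightarrow> R a \<in> ell2"
    "\<And>a. a \<in> ell2 \<Longrightarrow> ell2_norm (R a) \<le> u * ell2_norm a"
    using small ell2_onorm_minus_identity[OF U] by (simp_all add: u_def R_def[abs_def])
  have D: "D > 0" using frame_constants_pos by simp
  have M: "M x = ?s (U (?T x))" for x by (simp add: M_def gen_multiplier_def)
  have U_ell2: "U (?T x) \<in> ell2" for x
    using U analysis_op_ell2 by (simp add: ell2_bounded_op_def)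
  \<comment> \<open>Frame defect plus perturbation: the factors sqrt D from analysis and synthesis
    cancel 1/D, and q < 1 is exactly u < C/D.\<close>
  define q where "q = (1 - C / D) + u"
  have q: "norm (x - (1 / D) *\<^sub>R M x) \<le> q * norm x" for x
  proof -
    have "M x = ?s (\<lambda>n. ?T x n + R (?T x) n)" by (simp add: M R_def)
    also have "\<dots> = ?s (?T x) + ?s (R (?T x))"
      by (intro synthesis_op_add u analysis_op_ell2)
    finally have "x - (1 / D) *\<^sub>R M x = (x - (1 / D) *\<^sub>R ?s (?T x)) - (1 / D) *\<^sub>R ?s (R (?T x))"
      by (simp add: algebra_simps)
    then have "norm (x - (1 / D) *\<^sub>R M x)
        \<le> norm (x - (1 / D) *\<^sub>R ?s (?T x)) + norm ((1 / D) *\<^sub>R ?s (R (?T x)))"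
      by (metis norm_triangle_ineq4)
    moreover have "norm ((1 / D) *\<^sub>R ?s (R (?T x))) \<le> u * norm x"
    proof -
      have "norm (?s (R (?T x))) \<le> sqrt D * ell2_norm (R (?T x))"
        by (intro norm_synthesis_op u analysis_op_ell2)
      also have "\<dots> \<le> sqrt D * (u * (sqrt D * norm x))"
        using u D order_trans[OF u(4)[OF analysis_op_ell2] mult_left_mono[OF ell2_norm_analysis_op u(2)]]
        by (intro mult_left_mono) auto
      also have "\<dots> = (sqrt D * sqrt D) * (u * norm x)" by (simp only: mult_ac)
      also have "\<dots> = D * (u * norm x)" using D by simp
      finally show ?thesis using D by (simp add: field_simps)
    qed
    ultimately show ?thesis
      using frame_operator_near_identity[of x] by (simp add: q_def distrib_right)
  qed
  have add: "M (x + y) = M x + M y" for x y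
  proof -
    have "U (?T (x + y)) = (\<lambda>n. U (?T x) n + U (?T y) n)"
      using U analysis_op_ell2[of x] analysis_op_ell2[of y]
      by (simp add: ell2_bounded_op_def analysis_op_def ip_add_left)
    then show ?thesis by (simp add: M synthesis_op_add U_ell2)
  qed
  have scale: "M (c *\<^sub>C x) = c *\<^sub>C M x" for c x
  proof -
    have "U (?T (c *\<^sub>C x)) = (\<lambda>n. c *\<^sub>C U (?T x) n)"
      using U analysis_op_ell2[of x]
      by (simp add: ell2_bounded_op_def analysis_op_def ip_scaleC_left)
    then show ?thesis by (simp add: M synthesis_op_scaleC U_ell2)
  qed
  have lin: "linear M" by (intro linearI add) (simp add: scaleR_scaleC scale)
  have "bounded_linear M"
  proof (rule bounded_linear_intro)
    fix x
    have "norm ((1 / D) *\<^sub>R M x) \<le> norm x + norm (x - (1 / D) *\<^sub>R M x)"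
      using norm_triangle_ineq4[of x "x - (1 / D) *\<^sub>R M x"] by simp
    also have "\<dots> \<le> (1 + q) * norm x" using q[of x] by (simp add: distrib_right)
    finally show "norm (M x) \<le> norm x * (D * (1 + q))" using D by (simp add: field_simps)
  qed (simp_all add: add scaleR_scaleC scale)
  then show "bounded_clinear (gen_multiplier act ip U Y Y)"
    using scale by (simp add: bounded_clinear_def M_def)
  show "bij (gen_multiplier act ip U Y Y)"
    unfolding M_def[symmetric]
    by (rule bij_if_close_to_identity[OF lin _ _ q]) (use D u in \<open>auto simp: q_def\<close>)
qed

text \<open>The frame sum of the image at z is that of \<open>Y\<close> at \<open>W' z\<close>. The
  constants \<open>K\<close> and \<open>L\<close> compare <W' z, W' z> with <z,z> in the two
  directions, \<open>L\<close> because \<open>inv W'\<close> is adjointable too.\<close>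

lemma standard_frame_image:
  assumes W: "is_adjoint ip W W'" and b: "bij W"
  shows "standard_frame ip (\<lambda>n. W (Y n))"
proof -
  have adj: "ip z (W y) = ip (W' z) y" "ip (W y) z = ip y (W' z)" for y z
    using W is_adjoint_sym[OF W] by (simp_all add: is_adjoint_def)
  note W' = is_adjoint_bij[OF W b]
  obtain K where K: "K > 0" "\<And>x. cstar_positive (K *\<^sub>R ip x x - ip (W' x) (W' x))"
    using adjointable_ip_le[OF is_adjoint_sym[OF W]] by blast
  obtain L where L: "L > 0" "\<And>x. cstar_positive (L *\<^sub>R ip x x - ip (inv W' x) (inv W' x))"
    using adjointable_ip_le[OF is_adjoint_sym[OF W'(2)]] by blast
  have "frame_constants ip (\<lambda>n. W (Y n)) (C / L) (D * K)"
    unfolding frame_constants_def cstar_le_def adj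
  proof (intro conjI allI)
    show "0 < C / L" "0 < D * K" using frame_constants_pos K L by simp_all
    fix z
    show "summable (\<lambda>n. ip (W' z) (Y n) * ip (Y n) (W' z))" by (rule summable_frame)
    let ?F = "\<Sum>n. ip (W' z) (Y n) * ip (Y n) (W' z)" and ?N = "ip (W' z) (W' z)"
    have "cstar_positive ((?F - C *\<^sub>R ?N) + (C / L) *\<^sub>R (L *\<^sub>R ?N - ip z z))"
      using L(2)[of "W' z"] frame_constants_pos L(1) W'(1)
      by (intro cstar_positive_add frame_lower cstar_positive_scaleR) (simp_all add: bij_inv_cancel)
    then show "cstar_positive (?F - (C / L) *\<^sub>R ip z z)"
      using L(1) by (simp add: scaleR_diff_right)
    have "cstar_positive ((D *\<^sub>R ?N - ?F) + D *\<^sub>R (K *\<^sub>R ip z z - ?N))"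
      using frame_constants_pos by (intro cstar_positive_add frame_upper cstar_positive_scaleR K) simp
    then show "cstar_positive ((D * K) *\<^sub>R ip z z - ?F)"
      by (simp add: scaleR_diff_right)
  qed
  then show ?thesis unfolding standard_frame_def by blast
qed

end

end

text \<open>Both \<open>inv\<close> and \<open>module_adjoint\<close> are total, so the conclusion
  also asserts that M_{U,Y,Y} is invertible and \<open>inv W\<close> adjointable; this gives the two
  formulas their meaning.\<close>

theorem proposition3p7:
  fixes act :: "'a::unital_cstar_algebra \<Rightarrow> 'e::{complex_vector, banach} \<Rightarrow> 'e"
    and ip :: "'e \<Rightarrow> 'e \<Rightarrow> 'a"
    and Y X :: "nat \<Rightarrow> 'e" and W :: "'e \<Rightarrow> 'e"
    and U :: "(nat \<Rightarrow> 'a) \<Rightarrow> nat \<Rightarrow> 'a" and C D :: real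
  assumes "hilbert_module act ip"
    and "finitely_generated_module act \<or> countably_generated_module act"
    and "standard_frame ip Y" and "frame_bounds ip Y C D"
    and "adjointable ip W" and "bij W"
    and "\<And>n. X n = W (Y n)"
    and "ell2_bounded_op U"
    and "ell2_onorm (\<lambda>a n. U a n - a n) < C / D"
  shows "standard_frame ip X \<and>
    (invertible_op (gen_multiplier act ip U Y Y) \<and> adjointable ip (inv W)) \<and>
    (invertible_op (gen_multiplier act ip U Y X) \<and>
     inv (gen_multiplier act ip U Y X) =
       module_adjoint ip (inv W) \<circ> inv (gen_multiplier act ip U Y Y)) \<and>
    (invertible_op (gen_multiplier act ip U X Y) \<and>
     inv (gen_multiplier act ip U X Y) = inv (gen_multiplier act ip U Y Y) \<circ> inv W)"
proof -
  interpret hilbert_module act ip by fact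
  have frame: "frame_constants ip Y C D" using assms(4) by (simp add: frame_bounds_def)
  have X: "X = (\<lambda>n. W (Y n))" using assms(7) by (rule ext)
  obtain W' where W: "is_adjoint ip W W'" using assms(5) by (auto simp: adjointable_def)
  note W' = is_adjoint_bij[OF W assms(6)]
  let ?M = "gen_multiplier act ip U"
  have M: "invertible_op (?M Y Y)"
    by (rule gen_multiplier_invertible[OF frame assms(8,9)])
  have inv: "invertible_op W" "invertible_op W'"
    using invertible_opI is_adjoint_bounded_clinear W is_adjoint_sym W'(1) assms(6) by blast+
  have "analysis_op ip X = analysis_op ip Y \<circ> W'"
    using is_adjoint_sym[OF W] by (auto simp: fun_eq_iff analysis_op_def X is_adjoint_def)
  then have MYX: "?M Y X = ?M Y Y \<circ> W'" by (simp add: gen_multiplier_def comp_assoc)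
  \<comment> \<open>Proved pointwise, since \<open>W\<close> passes through the synthesis series
    only on elements of \<open>ell2\<close>.\<close>
  have MXY: "?M X Y = W \<circ> ?M Y Y"
  proof
    fix z
    have "U (analysis_op ip Y z) \<in> ell2"
      using assms(8) analysis_op_ell2[OF frame] by (simp add: ell2_bounded_op_def)
    then show "?M X Y z = (W \<circ> ?M Y Y) z"
      by (simp add: gen_multiplier_def X synthesis_op_image[OF frame W])
  qed
  show ?thesis
    unfolding MYX MXY module_adjoint_eq[OF W'(2)]
    using standard_frame_image[OF frame W assms(6)] W'(2) M inv
      invertible_op_compose[OF M inv(2)] invertible_op_compose[OF inv(1) M]
    by (auto simp: X adjointable_def)
qed

end
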